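(* Let $\varphi(x,y)$ be a formula with parameters in $\mathcal{U}$ and let $M\prec\mathcal{U}$ be a small model containing all the parameters from $\varphi(x,y)$. Let $\mu\in\mathfrak{M}_\varphi(\mathcal{U})$. Assume that (1) $\varphi(x,y)$ is NIP, (2) $\mu$ is $\varphi$-definable over $M$, and (3) $\mu$ is finitely satisfiable in $M$. Then for every $\epsilon>0$ there exist $a_1,\dots,a_n\in M^x$ such that, with $\overline{a}=(a_1,\dots,a_n)$, $$\sup_{b\in\mathcal{U}^y}|\mu(\varphi(x,b))-\operatorname{Av}(\overline{a})(\varphi(x,b))|<\epsilon.$$
   Context: $T$ is a complete first-order theory in a countable language, $\mathcal{U}$ is a monster model of $T$ (sufficiently saturated and strongly homogeneous), "small" means of cardinality smaller than the degree of saturation. For a partitioned formula $\varphi(x,y)\in\mathcal{L}(\mathcal{U})$, $\mathcal{L}_\varphi(\mathcal{U})$ is the Boolean algebra of definable subsets of $\mathcal{U}^x$ generated by $\{\varphi(x,b):b\in\mathcal{U}^y\}$. A $\varphi$-measure is a finitely additive probability measure on $\mathcal{L}_\varphi(\mathcal{U})$; $\mathfrak{M}_\varphi(\mathcal{U})$ is the set of all $\varphi$-measures. Let $M\prec\mathcal{U}$ contain the parameters of $\varphi$. $\mu\in\mathfrak{M}_\varphi(\mathcal{U})$ is $(M,\varphi)$-invariant if $\mu(\varphi(x,b))=\mu(\varphi(x,c))$ whenever $b,c\in\mathcal{U}^y$ and $\operatorname{tp}(b/M)=\operatorname{tp}(c/M)$; in this case $F_{\mu,M}^\varphi:S_y(M)\to[0,1]$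 is defined by $F_{\mu,M}^\varphi(q)=\mu(\varphi(x,b))$ for any $b\models q$. $\mu$ is $\varphi$-definable over $M$ if it is $(M,\varphi)$-invariant and $F_{\mu,M}^\varphi$ is continuous. $\mu$ is finitely satisfiable in $M$ if for every $\theta(x)\in\mathcal{L}_\varphi(\mathcal{U})$ with $\mu(\theta(x))>0$ there is $a\in M^x$ with $\mathcal{U}\models\theta(a)$. $\operatorname{Av}(a_1,\dots,a_n)(\psi(x))=\frac1n|\{1\le i\le n:\mathcal{U}\models\psi(a_i)\}|$. *)

theory Defs
  imports "HOL-Analysis.Analysis"
begin

unbundle cardinal_syntax

section \<open>First-order logic\<close>

datatype 'f trm = Var nat | App 'f "'f trm list"

datatype ('f, 'r) fm =
    Eq "'f trm" "'f trm"
  | Rel 'r "'f trm list"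
  | Neg "('f, 'r) fm"
  | Conj "('f, 'r) fm" "('f, 'r) fm"
  | Exists nat "('f, 'r) fm"

record ('f, 'r) lang =
  fsyms :: "'f set"
  rsyms :: "'r set"
  farity :: "'f \<Rightarrow> nat"
  rarity :: "'r \<Rightarrow> nat"

definition countable_lang :: "('f, 'r) lang \<Rightarrow> bool" where
  "countable_lang L \<longleftrightarrow> countable (fsyms L) \<and> countable (rsyms L)"

primrec wf_trm :: "('f, 'r) lang \<Rightarrow> 'f trm \<Rightarrow> bool" where
  "wf_trm L (Var v) \<longleftrightarrow> True"
| "wf_trm L (App f ts) \<longleftrightarrow> f \<in> fsyms L \<and> length ts = farity L f \<and> list_all (wf_trm L) ts"

primrec wf_fm :: "('f, 'r) lang \<Rightarrow> ('f, 'r) fm \<Rightarrow> bool" where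
  "wf_fm L (Eq s t) \<longleftrightarrow> wf_trm L s \<and> wf_trm L t"
| "wf_fm L (Rel r ts) \<longleftrightarrow> r \<in> rsyms L \<and> length ts = rarity L r \<and> list_all (wf_trm L) ts"
| "wf_fm L (Neg p) \<longleftrightarrow> wf_fm L p"
| "wf_fm L (Conj p q) \<longleftrightarrow> wf_fm L p \<and> wf_fm L q"
| "wf_fm L (Exists v p) \<longleftrightarrow> wf_fm L p"

primrec fv_trm :: "'f trm \<Rightarrow> nat set" where
  "fv_trm (Var v) = {v}"
| "fv_trm (App f ts) = \<Union> (set (map fv_trm ts))"

primrec fv :: "('f, 'r) fm \<Rightarrow> nat set" where
  "fv (Eq s t) = fv_trm s \<union> fv_trm t"
| "fv (Rel r ts) = \<Union> (set (map fv_trm ts))"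
| "fv (Neg p) = fv p"
| "fv (Conj p q) = fv p \<union> fv q"
| "fv (Exists v p) = fv p - {v}"

definition fmls :: "('f, 'r) lang \<Rightarrow> nat set \<Rightarrow> ('f, 'r) fm set" where
  "fmls L z = {p. wf_fm L p \<and> fv p \<subseteq> z}"

abbreviation sentences :: "('f, 'r) lang \<Rightarrow> ('f, 'r) fm set" where
  "sentences L \<equiv> fmls L {}"

record ('f, 'r, 'a) fo_struct =
  univ :: "'a set"
  fint :: "'f \<Rightarrow> 'a list \<Rightarrow> 'a"
  rint :: "'r \<Rightarrow> 'a list \<Rightarrow> bool"

definition is_struct :: "('f, 'r) lang \<Rightarrow> ('f, 'r, 'a) fo_struct \<Rightarrow> bool" where
  "is_struct L U \<longleftrightarrow> univ U \<noteq> {} \<and>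
     (\<forall>f\<in>fsyms L. \<forall>as. length as = farity L f \<and> set as \<subseteq> univ U \<longrightarrow> fint U f as \<in> univ U)"

primrec eval_trm :: "('f, 'r, 'a) fo_struct \<Rightarrow> (nat \<Rightarrow> 'a) \<Rightarrow> 'f trm \<Rightarrow> 'a" where
  "eval_trm U e (Var v) = e v"
| "eval_trm U e (App f ts) = fint U f (map (eval_trm U e) ts)"

primrec sat :: "('f, 'r, 'a) fo_struct \<Rightarrow> (nat \<Rightarrow> 'a) \<Rightarrow> ('f, 'r) fm \<Rightarrow> bool" where
  "sat U e (Eq s t) \<longleftrightarrow> eval_trm U e s = eval_trm U e t"
| "sat U e (Rel r ts) \<longleftrightarrow> rint U r (map (eval_trm U e) ts)"
| "sat U e (Neg p) \<longleftrightarrow> \<not> sat U e p"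
| "sat U e (Conj p q) \<longleftrightarrow> sat U e p \<and> sat U e q"
| "sat U e (Exists v p) \<longleftrightarrow> (\<exists>c\<in>univ U. sat U (e(v := c)) p)"

definition models :: "('f, 'r) lang \<Rightarrow> ('f, 'r, 'a) fo_struct \<Rightarrow> ('f, 'r) fm set \<Rightarrow> bool" where
  "models L U T \<longleftrightarrow> is_struct L U \<and> (\<forall>\<sigma>\<in>T. \<forall>e. range e \<subseteq> univ U \<longrightarrow> sat U e \<sigma>)"

text \<open>For a countable language the downward Loewenheim--Skolem theorem makes it harmless
  that satisfiability and entailment only refer to models whose universe is a nonempty set of
  natural numbers.\<close>

definition entails :: "('f, 'r) lang \<Rightarrow> ('f, 'r) fm set \<Rightarrow> ('f, 'r) fm \<Rightarrow> bool" where
  "entails L T \<sigma> \<longleftrightarrow> (\<forall>N :: ('f, 'r, nat) fo_struct. models L N T \<longrightarrow> models L N {\<sigma>})"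

definition complete_theory :: "('f, 'r) lang \<Rightarrow> ('f, 'r) fm set \<Rightarrow> bool" where
  "complete_theory L T \<longleftrightarrow> T \<subseteq> sentences L \<and>
     (\<exists>N :: ('f, 'r, nat) fo_struct. models L N T) \<and>
     (\<forall>\<sigma>\<in>sentences L. entails L T \<sigma> \<or> entails L T (Neg \<sigma>))"

definition elem_substruct ::
  "('f, 'r) lang \<Rightarrow> ('f, 'r, 'a) fo_struct \<Rightarrow> ('f, 'r, 'a) fo_struct \<Rightarrow> bool" where
  "elem_substruct L M U \<longleftrightarrow> is_struct L M \<and> is_struct L U \<and> univ M \<subseteq> univ U \<and>
     (\<forall>\<psi>\<in>fmls L UNIV. \<forall>e. range e \<subseteq> univ M \<longrightarrow> (sat M e \<psi> \<longleftrightarrow> sat U e \<psi>))"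


section \<open>Parameters, tuples and types\<close>

text \<open>The language \<open>L(A)\<close>: a new constant symbol \<open>Inr a\<close> is added for every \<open>a \<in> A\<close>;
  \<open>with_params U\<close> interprets it as \<open>a\<close>.\<close>

definition param_lang :: "('f, 'r) lang \<Rightarrow> 'a set \<Rightarrow> ('f + 'a, 'r) lang" where
  "param_lang L A = \<lparr>fsyms = Inl ` fsyms L \<union> Inr ` A, rsyms = rsyms L,
     farity = case_sum (farity L) (\<lambda>_. 0), rarity = rarity L\<rparr>"

definition with_params :: "('f, 'r, 'a) fo_struct \<Rightarrow> ('f + 'a, 'r, 'a) fo_struct" where
  "with_params U = \<lparr>univ = univ U, fint = case_sum (fint U) (\<lambda>a _. a), rint = rint U\<rparr>"

text \<open>A tuple of variables is a finite set \<open>z\<close> of variables, and \<open>U\<^sup>z\<close> is the set of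
  functions from \<open>z\<close> to the universe.\<close>

definition tuples :: "('f, 'r, 'a) fo_struct \<Rightarrow> nat set \<Rightarrow> (nat \<Rightarrow> 'a) set" where
  "tuples U z = z \<rightarrow>\<^sub>E univ U"

definition tp :: "('f, 'r) lang \<Rightarrow> ('f, 'r, 'a) fo_struct \<Rightarrow> 'a set \<Rightarrow> nat set \<Rightarrow> (nat \<Rightarrow> 'a) \<Rightarrow>
    ('f + 'a, 'r) fm set" where
  "tp L U A z b = {\<psi> \<in> fmls (param_lang L A) z. sat (with_params U) b \<psi>}"

text \<open>\<open>S\<^sub>z(A)\<close>: the complete types over \<open>A\<close> in the variables \<open>z\<close>, that is, the maximal sets of
  \<open>L(A)\<close>-formulas that are finitely satisfiable in \<open>U\<close>.\<close>

definition type_space :: "('f, 'r) lang \<Rightarrow> ('f, 'r, 'a) fo_struct \<Rightarrow> 'a set \<Rightarrow> nat set \<Rightarrow>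
    ('f + 'a, 'r) fm set set" where
  "type_space L U A z = {p. p \<subseteq> fmls (param_lang L A) z \<and>
     (\<forall>\<psi>\<in>fmls (param_lang L A) z. \<psi> \<in> p \<or> Neg \<psi> \<in> p) \<and>
     (\<forall>p0\<subseteq>p. finite p0 \<longrightarrow> (\<exists>c\<in>tuples U z. \<forall>\<psi>\<in>p0. sat (with_params U) c \<psi>))}"

definition type_topology :: "('f, 'r) lang \<Rightarrow> ('f, 'r, 'a) fo_struct \<Rightarrow> 'a set \<Rightarrow> nat set \<Rightarrow>
    ('f + 'a, 'r) fm set topology" where
  "type_topology L U A z = topology_generated_by
     {{p \<in> type_space L U A z. \<psi> \<in> p} | \<psi>. \<psi> \<in> fmls (param_lang L A) z}"

definition realizes :: "('f, 'r, 'a) fo_struct \<Rightarrow> nat set \<Rightarrow> (nat \<Rightarrow> 'a) \<Rightarrow> ('f + 'a, 'r) fm set \<Rightarrow> bool"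
  where "realizes U z b p \<longleftrightarrow> b \<in> tuples U z \<and> (\<forall>\<psi>\<in>p. sat (with_params U) b \<psi>)"


section \<open>Monster models\<close>

definition small :: "'k rel \<Rightarrow> 'a set \<Rightarrow> bool" where
  "small \<kappa> A \<longleftrightarrow> |A| <o \<kappa>"

definition saturated :: "('f, 'r) lang \<Rightarrow> 'k rel \<Rightarrow> ('f, 'r, 'a) fo_struct \<Rightarrow> bool" where
  "saturated L \<kappa> U \<longleftrightarrow> (\<forall>A z. A \<subseteq> univ U \<longrightarrow> small \<kappa> A \<longrightarrow> finite z \<longrightarrow>
     (\<forall>p\<in>type_space L U A z. \<exists>b. realizes U z b p))"

definition partial_elementary ::
  "('f, 'r) lang \<Rightarrow> ('f, 'r, 'a) fo_struct \<Rightarrow> 'a set \<Rightarrow> ('a \<Rightarrow> 'a) \<Rightarrow> bool" where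
  "partial_elementary L U A f \<longleftrightarrow> f ` A \<subseteq> univ U \<and>
     (\<forall>\<psi>\<in>fmls L UNIV. \<forall>e. e ` fv \<psi> \<subseteq> A \<longrightarrow> (sat U e \<psi> \<longleftrightarrow> sat U (f \<circ> e) \<psi>))"

definition automorphism ::
  "('f, 'r) lang \<Rightarrow> ('f, 'r, 'a) fo_struct \<Rightarrow> ('a \<Rightarrow> 'a) \<Rightarrow> bool" where
  "automorphism L U g \<longleftrightarrow> bij_betw g (univ U) (univ U) \<and>
     (\<forall>f\<in>fsyms L. \<forall>as. length as = farity L f \<and> set as \<subseteq> univ U \<longrightarrow>
        g (fint U f as) = fint U f (map g as)) \<and>
     (\<forall>r\<in>rsyms L. \<forall>as. length as = rarity L r \<and> set as \<subseteq> univ U \<longrightarrow>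
        (rint U r as \<longleftrightarrow> rint U r (map g as)))"

definition strongly_homogeneous ::
  "('f, 'r) lang \<Rightarrow> 'k rel \<Rightarrow> ('f, 'r, 'a) fo_struct \<Rightarrow> bool" where
  "strongly_homogeneous L \<kappa> U \<longleftrightarrow> (\<forall>A f. A \<subseteq> univ U \<longrightarrow> small \<kappa> A \<longrightarrow>
     partial_elementary L U A f \<longrightarrow> (\<exists>g. automorphism L U g \<and> (\<forall>a\<in>A. g a = f a)))"

text \<open>The degree of saturation \<open>\<kappa>\<close> is an arbitrary uncountable cardinal.\<close>

definition monster_model ::
  "('f, 'r) lang \<Rightarrow> ('f, 'r) fm set \<Rightarrow> 'k rel \<Rightarrow> ('f, 'r, 'a) fo_struct \<Rightarrow> bool" where
  "monster_model L T \<kappa> U \<longleftrightarrow> models L U T \<and> Card_order \<kappa> \<and> natLeq <o \<kappa> \<and>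
     saturated L \<kappa> U \<and> strongly_homogeneous L \<kappa> U"


section \<open>Local Keisler measures\<close>

text \<open>The instance \<open>\<phi>(x, b)\<close>, as a definable subset of \<open>U\<^sup>x\<close>.\<close>

definition inst :: "('f, 'r, 'a) fo_struct \<Rightarrow> nat set \<Rightarrow> ('f + 'a, 'r) fm \<Rightarrow> (nat \<Rightarrow> 'a) \<Rightarrow>
    (nat \<Rightarrow> 'a) set" where
  "inst U x \<phi> b = {a \<in> tuples U x. sat (with_params U) (override_on b a x) \<phi>}"

definition local_algebra :: "('f, 'r, 'a) fo_struct \<Rightarrow> nat set \<Rightarrow> nat set \<Rightarrow> ('f + 'a, 'r) fm \<Rightarrow>
    (nat \<Rightarrow> 'a) set set" where
  "local_algebra U x y \<phi> = algebra (tuples U x) hull (inst U x \<phi> ` tuples U y)"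

definition local_measure :: "('f, 'r, 'a) fo_struct \<Rightarrow> nat set \<Rightarrow> nat set \<Rightarrow> ('f + 'a, 'r) fm \<Rightarrow>
    ((nat \<Rightarrow> 'a) set \<Rightarrow> real) \<Rightarrow> bool" where
  "local_measure U x y \<phi> \<mu> \<longleftrightarrow>
     (\<forall>S\<in>local_algebra U x y \<phi>. 0 \<le> \<mu> S) \<and> \<mu> (tuples U x) = 1 \<and>
     Measure_Space.additive (local_algebra U x y \<phi>) \<mu>"

definition NIP :: "('f, 'r, 'a) fo_struct \<Rightarrow> nat set \<Rightarrow> nat set \<Rightarrow> ('f + 'a, 'r) fm \<Rightarrow> bool" where
  "NIP U x y \<phi> \<longleftrightarrow> \<not> (\<exists>(a :: nat \<Rightarrow> nat \<Rightarrow> 'a) (b :: nat set \<Rightarrow> nat \<Rightarrow> 'a).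
     range a \<subseteq> tuples U x \<and> range b \<subseteq> tuples U y \<and>
     (\<forall>i I. a i \<in> inst U x \<phi> (b I) \<longleftrightarrow> i \<in> I))"

definition invariant_measure :: "('f, 'r) lang \<Rightarrow> ('f, 'r, 'a) fo_struct \<Rightarrow> ('f, 'r, 'a) fo_struct \<Rightarrow>
    nat set \<Rightarrow> nat set \<Rightarrow> ('f + 'a, 'r) fm \<Rightarrow> ((nat \<Rightarrow> 'a) set \<Rightarrow> real) \<Rightarrow> bool" where
  "invariant_measure L U M x y \<phi> \<mu> \<longleftrightarrow> (\<forall>b\<in>tuples U y. \<forall>c\<in>tuples U y.
     tp L U (univ M) y b = tp L U (univ M) y c \<longrightarrow> \<mu> (inst U x \<phi> b) = \<mu> (inst U x \<phi> c))"

text \<open>\<open>F q = \<mu>(\<phi>(x, b))\<close> for any \<open>b\<close> realizing \<open>q\<close>; meaningful for invariant \<open>\<mu>\<close> and small \<open>M\<close>,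
  since every type over \<open>M\<close> is then realized in \<open>U\<close>.\<close>

definition fibre_map :: "('f, 'r, 'a) fo_struct \<Rightarrow> nat set \<Rightarrow> nat set \<Rightarrow> ('f + 'a, 'r) fm \<Rightarrow>
    ((nat \<Rightarrow> 'a) set \<Rightarrow> real) \<Rightarrow> ('f + 'a, 'r) fm set \<Rightarrow> real" where
  "fibre_map U x y \<phi> \<mu> q = \<mu> (inst U x \<phi> (SOME b. realizes U y b q))"

definition definable_measure :: "('f, 'r) lang \<Rightarrow> ('f, 'r, 'a) fo_struct \<Rightarrow> ('f, 'r, 'a) fo_struct \<Rightarrow>
    nat set \<Rightarrow> nat set \<Rightarrow> ('f + 'a, 'r) fm \<Rightarrow> ((nat \<Rightarrow> 'a) set \<Rightarrow> real) \<Rightarrow> bool" where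
  "definable_measure L U M x y \<phi> \<mu> \<longleftrightarrow> invariant_measure L U M x y \<phi> \<mu> \<and>
     continuous_map (type_topology L U (univ M) y) (top_of_set {0..1}) (fibre_map U x y \<phi> \<mu>)"

definition finitely_satisfiable_measure :: "('f, 'r, 'a) fo_struct \<Rightarrow> ('f, 'r, 'a) fo_struct \<Rightarrow>
    nat set \<Rightarrow> nat set \<Rightarrow> ('f + 'a, 'r) fm \<Rightarrow> ((nat \<Rightarrow> 'a) set \<Rightarrow> real) \<Rightarrow> bool" where
  "finitely_satisfiable_measure U M x y \<phi> \<mu> \<longleftrightarrow>
     (\<forall>\<theta>\<in>local_algebra U x y \<phi>. 0 < \<mu> \<theta> \<longrightarrow> (\<exists>a\<in>tuples M x. a \<in> \<theta>))"

definition Av :: "(nat \<Rightarrow> 'a) list \<Rightarrow> (nat \<Rightarrow> 'a) set \<Rightarrow> real" where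
  "Av as S = real (card {i. i < length as \<and> as ! i \<in> S}) / real (length as)"

end

theory Submission
  imports Defs
begin

text \<open>Write \<open>F b\<close> for \<open>\<mu>(\<phi>(x,b))\<close> and \<open>E a b\<close> for the truth of \<open>\<phi>(a,b)\<close>. Call a pair \<open>(b, s)\<close> with
\<open>s = 1\<close> or \<open>s = -1\<close> a signed instance, and \<open>s (F b - E a b)\<close> its deviation at \<open>a\<close>. Suppose
that the average of \<open>E\<close> over any finite sequence from \<open>M\<^sup>x\<close> misses \<open>F\<close> by at least \<open>\<epsilon>\<close> at
some instance. Duality between points and instances turns this into a contradiction.

For a finite set \<open>A\<close> of points of \<open>M\<close>, the assumption says that every weighting of \<open>A\<close> is
beaten by some signed instance: the weighted mean of its deviation is at least \<open>\<epsilon>/2\<close>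
(\<open>weighted_deviation\<close>). The method of multiplicative weights (\<open>multiplicative_weights\<close>), a
constructive minimax theorem, then produces one list of signed instances whose mean
deviation is at least \<open>\<epsilon>/8\<close> at every \<open>a \<in> A\<close> simultaneously.

The length of this list grows with \<open>A\<close>. By NIP and saturation the sets that points cut out
on finite sets of instances have bounded Vapnik--Chervonenkis dimension
(\<open>NIP_bounds_dual_shattering\<close>), so by Sauer and Shelah there are only polynomially many of
them. A list can therefore be halved repeatedly with little effect on its mean deviations,
until its length is a number \<open>N\<close> that does not depend on \<open>A\<close> (\<open>repeated_halving\<close>,
\<open>bounded_deviation_sample\<close>).

With \<open>N\<close> fixed, saturation replaces the finite sets \<open>A\<close> by all of \<open>M\<^sup>x\<close>: some list of \<open>N\<close>
signed instances has positive mean deviation at every point of \<open>M\<close>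
(\<open>uniform_deviation_sample\<close>). Definability of \<open>\<mu>\<close> enters here, since it makes the condition
that \<open>F b\<close> lies in a closed interval expressible by a set of formulas over \<open>M\<close>
(\<open>measure_preimage_type_definable\<close>).

But the mean deviation along any fixed list has \<open>\<mu>\<close>-integral \<open>0\<close>, and it is constant on each
part of a finite partition of the points in the local algebra. A part of positive measure
has a point in \<open>M\<close>. So it is at most \<open>0\<close> at some point of \<open>M\<close>
(\<open>finitely_satisfiable_mean_deviation\<close>).\<close>

section \<open>Shattering and the number of traces\<close>

definition shatters :: "'i set set \<Rightarrow> 'i set \<Rightarrow> bool" where
  "shatters F S \<longleftrightarrow> (\<forall>B\<subseteq>S. \<exists>T\<in>F. T \<inter> S = B)"

text \<open>Pajor's sharpening of the Sauer--Shelah lemma, which makes the induction on the ground set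
smooth. Split \<open>F\<close> at a new element \<open>z\<close> into the traces \<open>F0\<close> and \<open>F1\<close> of the members without
and with \<open>z\<close>. A set shattered by \<open>F0 \<union> F1\<close> is shattered by \<open>F\<close>, and a set shattered by
\<open>F0 \<inter> F1\<close> can also be enlarged by \<open>z\<close>; the two cardinalities add up.\<close>

lemma card_le_card_shattered:
  assumes "finite X" "F \<subseteq> Pow X"
  shows "card F \<le> card {S. S \<subseteq> X \<and> shatters F S}"
  using assms
proof (induction X arbitrary: F rule: finite_induct)
  case empty
  then have "F = {} \<or> F = {{}}" by auto
  then show ?case
  proof
    assume "F = {{}}"
    then have "{S. S \<subseteq> {} \<and> shatters F S} = {{}}" by (auto simp: shatters_def)
    with \<open>F = {{}}\<close> show ?thesis by simp
  qed simp
next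
  case (insert z X)
  let ?Sh = "\<lambda>F. {S. S \<subseteq> X \<and> shatters F S}"
  define F0 where "F0 = {T\<in>F. z \<notin> T}"
  define F1 where "F1 = {T. z \<notin> T \<and> insert z T \<in> F}"
  have sub: "F0 \<subseteq> Pow X" "F1 \<subseteq> Pow X"
    using insert.prems by (auto simp: F0_def F1_def)
  have fin: "finite F0" "finite F1"
    using sub insert.hyps(1) by (auto intro: finite_subset[of _ "Pow X"])
  have split: "F = F0 \<union> insert z ` F1"
  proof -
    have "T \<in> insert z ` F1" if "T \<in> F" "z \<in> T" for T
      by (rule image_eqI[of _ _ "T - {z}"]) (use that in \<open>auto simp: F1_def insert_absorb\<close>)
    then show ?thesis by (auto simp: F0_def F1_def)
  qed
  have inj: "inj_on (insert z) G" if "\<And>T. T \<in> G \<Longrightarrow> z \<notin> T" for G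
    using that by (metis (no_types, lifting) inj_onI insert_ident)
  have "inj_on (insert z) F1" by (rule inj) (simp add: F1_def)
  moreover have "F0 \<inter> insert z ` F1 = {}" by (auto simp: F0_def)
  ultimately have "card F = card F0 + card F1"
    using fin by (subst split) (simp add: card_Un_disjoint card_image)
  also have "\<dots> = card (F0 \<union> F1) + card (F0 \<inter> F1)"
    using fin by (rule card_Un_Int)
  also have "\<dots> \<le> card (?Sh (F0 \<union> F1)) + card (?Sh (F0 \<inter> F1))"
    using sub by (intro add_mono insert.IH) auto
  also have "\<dots> = card (?Sh (F0 \<union> F1)) + card (insert z ` ?Sh (F0 \<inter> F1))"
  proof -
    have "inj_on (insert z) (?Sh (F0 \<inter> F1))"
      by (rule inj) (use insert.hyps(2) in auto)
    then show ?thesis by (simp add: card_image)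
  qed
  also have "\<dots> = card (?Sh (F0 \<union> F1) \<union> insert z ` ?Sh (F0 \<inter> F1))"
    using insert.hyps by (intro card_Un_disjoint[symmetric]) auto
  also have "\<dots> \<le> card {S. S \<subseteq> insert z X \<and> shatters F S}"
  proof (rule card_mono)
    show "finite {S. S \<subseteq> insert z X \<and> shatters F S}"
      using insert.hyps(1) by auto
    have "shatters F S" if S: "S \<subseteq> X" "shatters (F0 \<union> F1) S" for S
      unfolding shatters_def
    proof (intro allI impI)
      fix B assume "B \<subseteq> S"
      with S(2) obtain T where T: "T \<in> F0 \<union> F1" "T \<inter> S = B" unfolding shatters_def by blast
      have "z \<notin> S" using S(1) insert.hyps(2) by auto
      then have "insert z T \<inter> S = B" using T(2) by auto
      then show "\<exists>T\<in>F. T \<inter> S = B"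
        using T unfolding F0_def F1_def by blast
    qed
    moreover have "shatters F (insert z S)" if S: "S \<subseteq> X" "shatters (F0 \<inter> F1) S" for S
      unfolding shatters_def
    proof (intro allI impI)
      fix B assume B: "B \<subseteq> insert z S"
      then have "B - {z} \<subseteq> S" by auto
      with S(2) obtain T where T: "T \<in> F0" "T \<in> F1" "T \<inter> S = B - {z}"
        unfolding shatters_def by blast
      show "\<exists>T\<in>F. T \<inter> insert z S = B"
      proof (cases "z \<in> B")
        case True
        have "insert z T \<inter> insert z S = insert z (T \<inter> S)" by blast
        with True T(3) have "insert z T \<inter> insert z S = B" by (simp add: insert_absorb)
        then show ?thesis using T(2) unfolding F1_def by blast
      next
        case False
        have "T \<inter> insert z S = T \<inter> S" using T(1) by (auto simp: F0_def)
        with False T(3) have "T \<inter> insert z S = B" by simp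
        then show ?thesis using T(1) unfolding F0_def by blast
      qed
    qed
    ultimately show "?Sh (F0 \<union> F1) \<union> insert z ` ?Sh (F0 \<inter> F1)
        \<subseteq> {S. S \<subseteq> insert z X \<and> shatters F S}"
      by auto
  qed
  finally show ?case .
qed

lemma card_bounded_subsets_le:
  assumes "finite X"
  shows "card {S. S \<subseteq> X \<and> card S \<le> d} \<le> (card X + 1) ^ d"
proof (induction d)
  case 0
  have "{S. S \<subseteq> X \<and> card S \<le> 0} = {{}}"
    using assms finite_subset by fastforce
  then show ?case by simp
next
  case (Suc d)
  let ?C = "\<lambda>d. {S. S \<subseteq> X \<and> card S \<le> d}"
  define add where "add = (\<lambda>(u, S). case u of None \<Rightarrow> S | Some a \<Rightarrow> insert (a :: 'a) S)"
  have "?C (Suc d) \<subseteq> add ` (insert None (Some ` X) \<times> ?C d)"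
  proof
    fix S assume S: "S \<in> ?C (Suc d)"
    show "S \<in> add ` (insert None (Some ` X) \<times> ?C d)"
    proof (cases "S = {}")
      case True
      then show ?thesis by (intro image_eqI[of _ _ "(None, {})"]) (auto simp: add_def)
    next
      case False
      then obtain a where "a \<in> S" by auto
      then show ?thesis
        using S assms finite_subset[of S X]
        by (intro image_eqI[of _ _ "(Some a, S - {a})"]) (auto simp: add_def)
    qed
  qed
  then have "card (?C (Suc d)) \<le> card (insert None (Some ` X) \<times> ?C d)"
    using assms by (intro surj_card_le) auto
  also have "\<dots> = (card X + 1) * card (?C d)"
    using assms by (simp add: card_cartesian_product card_image)
  also have "\<dots> \<le> (card X + 1) * (card X + 1) ^ d"
    using Suc by (rule mult_left_mono) simp
  finally show ?case by simp
qed

lemma sauer_shelah: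
  assumes "finite X" "F \<subseteq> Pow X" "\<And>S. S \<subseteq> X \<Longrightarrow> shatters F S \<Longrightarrow> card S \<le> d"
  shows "card F \<le> (card X + 1) ^ d"
proof -
  have "card F \<le> card {S. S \<subseteq> X \<and> shatters F S}"
    using assms by (intro card_le_card_shattered)
  also have "\<dots> \<le> card {S. S \<subseteq> X \<and> card S \<le> d}"
    using assms by (intro card_mono) auto
  also have "\<dots> \<le> (card X + 1) ^ d"
    using assms(1) by (rule card_bounded_subsets_le)
  finally show ?thesis .
qed

section \<open>Multiplicative weights\<close>

lemma exp_le_quadratic:
  fixes u :: real
  assumes "\<bar>u\<bar> \<le> 1"
  shows "exp u \<le> 1 + u + u\<^sup>2"
proof (cases "0 \<le> u")
  case True
  then show ?thesis using assms exp_bound[of u] by simp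
next
  case False
  define t where "t = - u"
  have t: "0 \<le> t" using False by (simp add: t_def)
  have "(1 - t + t\<^sup>2) * (1 + t + t\<^sup>2 / 2) = 1 + t\<^sup>2 / 2 + t ^ 3 / 2 + t ^ 4 / 2"
    by (simp add: power2_eq_square power3_eq_cube power4_eq_xxxx field_simps)
  then have "1 \<le> (1 - t + t\<^sup>2) * (1 + t + t\<^sup>2 / 2)" using t by simp
  also have "\<dots> \<le> (1 - t + t\<^sup>2) * exp t"
  proof (rule mult_left_mono)
    show "1 + t + t\<^sup>2 / 2 \<le> exp t" using exp_lower_Taylor_quadratic[OF t] .
    have "0 \<le> (1 - t)\<^sup>2 + t" using t by simp
    then show "0 \<le> 1 - t + t\<^sup>2" using t by (simp add: power2_eq_square algebra_simps)
  qed
  finally have "exp (- t) \<le> 1 - t + t\<^sup>2"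
    by (simp add: exp_minus field_simps)
  then show ?thesis by (simp add: t_def)
qed

text \<open>In round \<open>i\<close> one may choose an element of \<open>Opt i\<close>, whose payoff to \<open>v\<close> is \<open>h v\<close>. If for
every weighting of \<open>V\<close> some choice has average payoff at least \<open>c\<close>, then choices can be made
that give almost \<open>c\<close> per round to all \<open>v\<close> at once. Weight \<open>v\<close> by \<open>exp (- r * G v)\<close>, where
\<open>G v\<close> is its gain so far, so that losers count most, and answer that weighting: the total
weight is then multiplied by at most \<open>exp (- r * (c - r))\<close> in each round, and no single
weight can exceed the total.

The lemma is used twice, with a fixed set of choices as a minimax theorem, and with \<open>c = 0\<close>
and two opposite choices per round as a derandomized Chernoff bound.\<close>

lemma multiplicative_weights:
  fixes h :: "'v \<Rightarrow> 'p \<Rightarrow> real" and c r :: real and n :: nat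
  assumes V: "finite V" "V \<noteq> {}" and r: "0 < r" "r \<le> 1"
    and bd: "\<And>v i p. v \<in> V \<Longrightarrow> p \<in> Opt i \<Longrightarrow> \<bar>h v p\<bar> \<le> 1"
    and opt: "\<And>i W. (\<And>v. v \<in> V \<Longrightarrow> 0 < W v) \<Longrightarrow>
                \<exists>p\<in>Opt i. (\<Sum>v\<in>V. W v * h v p) \<ge> c * (\<Sum>v\<in>V. W v)"
  shows "\<exists>f. (\<forall>i<n. f i \<in> Opt i) \<and>
           (\<forall>v\<in>V. (\<Sum>i<n. h v (f i)) \<ge> (c - r) * n - ln (card V) / r)"
proof -
  have "\<exists>f. (\<forall>i<n. f i \<in> Opt i) \<and>
      (\<Sum>v\<in>V. exp (- r * (\<Sum>i<n. h v (f i)))) \<le> card V * exp (- (r * (c - r)) * n)"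
  proof (induction n)
    case 0
    then show ?case by simp
  next
    case (Suc n)
    then obtain f where f: "\<forall>i<n. f i \<in> Opt i"
      "(\<Sum>v\<in>V. exp (- r * (\<Sum>i<n. h v (f i)))) \<le> card V * exp (- (r * (c - r)) * n)"
      by blast
    define W where "W v = exp (- r * (\<Sum>i<n. h v (f i)))" for v
    obtain p where p: "p \<in> Opt n" "(\<Sum>v\<in>V. W v * h v p) \<ge> c * (\<Sum>v\<in>V. W v)"
      using opt[of W n] by (auto simp: W_def)
    have step: "W v * exp (- r * h v p) \<le> W v * (1 + r\<^sup>2) - r * (W v * h v p)"
      if "v \<in> V" for v
    proof -
      have b: "\<bar>h v p\<bar> \<le> 1" using bd that p(1) by blast
      then have "\<bar>- r * h v p\<bar> \<le> 1"
        using r mult_mono[of r 1 "\<bar>h v p\<bar>" 1] by (simp add: abs_mult)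
      then have "exp (- r * h v p) \<le> 1 + - r * h v p + (- r * h v p)\<^sup>2"
        by (rule exp_le_quadratic)
      also have "(- r * h v p)\<^sup>2 \<le> r\<^sup>2"
        using b by (simp add: power_mult_distrib abs_square_le_1 mult_left_le)
      finally have "W v * exp (- r * h v p) \<le> W v * (1 + - r * h v p + r\<^sup>2)"
        by (intro mult_left_mono) (auto simp: W_def)
      then show ?thesis by (simp add: algebra_simps)
    qed
    have "(\<Sum>v\<in>V. exp (- r * (\<Sum>i<Suc n. h v ((f(n := p)) i)))) = (\<Sum>v\<in>V. W v * exp (- r * h v p))"
      by (intro sum.cong refl) (simp add: W_def exp_add[symmetric] algebra_simps)
    also have "\<dots> \<le> (\<Sum>v\<in>V. W v * (1 + r\<^sup>2) - r * (W v * h v p))"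
      using step by (rule sum_mono)
    also have "\<dots> = (\<Sum>v\<in>V. W v) * (1 + r\<^sup>2) - r * (\<Sum>v\<in>V. W v * h v p)"
      by (simp add: sum_subtractf sum_distrib_left sum_distrib_right)
    also have "\<dots> \<le> (\<Sum>v\<in>V. W v) * (1 + r\<^sup>2) - r * (c * (\<Sum>v\<in>V. W v))"
      using p(2) r(1) by simp
    also have "\<dots> = (\<Sum>v\<in>V. W v) * (1 + - (r * (c - r)))"
      by (simp add: power2_eq_square algebra_simps)
    also have "\<dots> \<le> (\<Sum>v\<in>V. W v) * exp (- (r * (c - r)))"
      by (intro mult_left_mono exp_ge_add_one_self sum_nonneg) (simp add: W_def)
    also have "\<dots> \<le> (card V * exp (- (r * (c - r)) * n)) * exp (- (r * (c - r)))"
      using f(2) by (intro mult_right_mono) (auto simp: W_def)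
    also have "\<dots> = card V * exp (- (r * (c - r)) * Suc n)"
      by (simp add: exp_add[symmetric] algebra_simps)
    finally show ?case
      using f(1) p(1) by (intro exI[of _ "f(n := p)"]) (auto simp: less_Suc_eq)
  qed
  then obtain f where f: "\<forall>i<n. f i \<in> Opt i"
    "(\<Sum>v\<in>V. exp (- r * (\<Sum>i<n. h v (f i)))) \<le> card V * exp (- (r * (c - r)) * n)"
    by blast
  have "(\<Sum>i<n. h v (f i)) \<ge> (c - r) * n - ln (card V) / r" if v: "v \<in> V" for v
  proof -
    have "exp (- r * (\<Sum>i<n. h v (f i))) \<le> (\<Sum>v\<in>V. exp (- r * (\<Sum>i<n. h v (f i))))"
      using v V(1) by (intro member_le_sum) auto
    also note f(2)
    also have "card V * exp (- (r * (c - r)) * n) = exp (ln (card V) - r * (c - r) * n)"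
    proof -
      have "exp (ln (real (card V))) = card V" using V by (simp add: card_gt_0_iff)
      moreover have "exp (ln (real (card V)) - r * (c - r) * n)
          = exp (ln (real (card V))) * exp (- (r * (c - r)) * n)"
        by (simp flip: exp_add)
      ultimately show ?thesis by metis
    qed
    finally have "r * ((c - r) * n) - ln (card V) \<le> r * (\<Sum>i<n. h v (f i))" by simp
    then have "(r * ((c - r) * n) - ln (card V)) / r \<le> (\<Sum>i<n. h v (f i))"
      using r(1) by (simp add: divide_le_eq mult.commute)
    then show ?thesis using r(1) by (simp add: diff_divide_distrib)
  qed
  with f(1) show ?thesis by blast
qed

section \<open>Shortening lists by halving\<close>

definition mean :: "('p \<Rightarrow> real) \<Rightarrow> 'p list \<Rightarrow> real" where
  "mean f ps = sum_list (map f ps) / length ps"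

text \<open>The functions \<open>g a\<close> take polynomially many shapes on the members of a list. The bound is in
terms of lists, possibly with repetitions, because lists are what \<open>halving\<close> shortens.\<close>

definition poly_growth :: "nat \<Rightarrow> ('a \<Rightarrow> 'p \<Rightarrow> real) \<Rightarrow> 'a set \<Rightarrow> 'p set \<Rightarrow> bool" where
  "poly_growth d g A P \<longleftrightarrow>
     (\<forall>ps. set ps \<subseteq> P \<longrightarrow> card ((\<lambda>a. restrict (g a) (set ps)) ` A) \<le> (length ps + 1) ^ d)"

text \<open>Pair the two halves of the list and keep one element of each pair. Opposite choices in a
pair have opposite effects on the mean, so on any weighting one of them does no harm, and
\<open>multiplicative_weights\<close> with \<open>c = 0\<close> applies. The logarithmic term counts the shapes of the
functions \<open>g a\<close> on the list rather than the elements of \<open>A\<close>; this is where polynomial growth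
pays off.\<close>

lemma halving:
  assumes A: "finite A" "A \<noteq> {}" and bd: "\<And>a p. a \<in> A \<Longrightarrow> p \<in> P \<Longrightarrow> \<bar>g a p\<bar> \<le> (1::real)"
    and gr: "poly_growth d g A P"
    and ps: "set ps \<subseteq> P" "length ps = 2 * n" and n: "0 < n" and r: "0 < r" "r \<le> 1"
  shows "\<exists>qs. set qs \<subseteq> P \<and> length qs = n \<and>
    (\<forall>a\<in>A. mean (g a) qs \<ge> mean (g a) ps - r - d * ln (2 * real n + 1) / (real n * r))"
proof -
  define V where "V = (\<lambda>a. restrict (g a) (set ps)) ` A"
  define us vs where "us = take n ps" and "vs = drop n ps"
  have uv: "ps = us @ vs" "length us = n" "length vs = n"
    using ps(2) by (auto simp: us_def vs_def)
  have mem: "us ! i \<in> set ps" "vs ! i \<in> set ps" if "i < n" for i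
    using that uv by auto
  define Opt where "Opt i = (if i < n then {(us ! i, vs ! i), (vs ! i, us ! i)}
     else {(us ! 0, us ! 0)})" for i
  define h where "h v pq = (v (fst pq) - v (snd pq)) / (2::real)" for v and pq :: "'b \<times> 'b"
  have V: "finite V" "V \<noteq> {}" using A by (auto simp: V_def)
  have "\<bar>h v p\<bar> \<le> 1" if vp: "v \<in> V" "p \<in> Opt i" for v p i
  proof -
    obtain a where a: "a \<in> A" "v = restrict (g a) (set ps)" using vp(1) by (auto simp: V_def)
    have "fst p \<in> set ps" "snd p \<in> set ps"
      using vp(2) mem n by (auto simp: Opt_def split: if_splits)
    then have "\<bar>v (fst p)\<bar> \<le> 1" "\<bar>v (snd p)\<bar> \<le> 1" using a bd ps(1) by auto
    then have "\<bar>v (fst p) - v (snd p)\<bar> \<le> 2" by linarith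
    then show ?thesis by (simp add: h_def)
  qed
  moreover have "\<exists>p\<in>Opt i. (\<Sum>v\<in>V. W v * h v p) \<ge> 0 * (\<Sum>v\<in>V. W v)" for i W
  proof (cases "i < n")
    case True
    have "(\<Sum>v\<in>V. W v * h v (us ! i, vs ! i)) = - (\<Sum>v\<in>V. W v * h v (vs ! i, us ! i))"
      unfolding sum_negf[symmetric]
    proof (intro sum.cong refl)
      fix v
      have "h v (us ! i, vs ! i) = - h v (vs ! i, us ! i)" by (simp add: h_def field_simps)
      then show "W v * h v (us ! i, vs ! i) = - (W v * h v (vs ! i, us ! i))" by simp
    qed
    then show ?thesis using True by (auto simp: Opt_def)
  next
    case False
    then show ?thesis by (simp add: Opt_def h_def)
  qed
  ultimately obtain f where f: "\<forall>i<n. f i \<in> Opt i"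
    "\<forall>v\<in>V. (\<Sum>i<n. h v (f i)) \<ge> (0 - r) * n - ln (card V) / r"
    using multiplicative_weights[OF V r, where Opt = Opt and h = h and c = 0 and n = n] by blast
  define qs where "qs = map (fst \<circ> f) [0..<n]"
  have fmem: "fst (f i) \<in> set ps" "snd (f i) \<in> set ps" if "i < n" for i
  proof -
    have "f i \<in> Opt i" using f(1) that by blast
    then show "fst (f i) \<in> set ps" "snd (f i) \<in> set ps"
      using that mem[OF that] by (auto simp: Opt_def)
  qed
  have "mean (g a) qs \<ge> mean (g a) ps - r - d * ln (2 * real n + 1) / (real n * r)" if a: "a \<in> A" for a
  proof -
    have cV: "0 < card V" using V by (simp add: card_gt_0_iff)
    have "card V \<le> (2 * n + 1) ^ d"
      using gr ps unfolding poly_growth_def V_def by metis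
    then have "ln (card V) \<le> ln ((2 * real n + 1) ^ d)"
      using cV of_nat_mono[of "card V" "(2 * n + 1) ^ d", where 'a = real] by (intro ln_mono) (auto simp: add.commute)
    also have "\<dots> = d * ln (2 * real n + 1)"
      by (simp add: ln_realpow)
    finally have lnV: "ln (card V) \<le> d * ln (2 * real n + 1)" .
    have "(\<Sum>i<n. h (restrict (g a) (set ps)) (f i)) \<ge> - r * n - ln (card V) / r"
      using f(2) a by (auto simp: V_def)
    moreover have "(\<Sum>i<n. h (restrict (g a) (set ps)) (f i))
        = (\<Sum>i<n. (g a (fst (f i)) - g a (snd (f i))) / 2)"
      using fmem by (intro sum.cong) (auto simp: h_def)
    moreover have "ln (card V) / r \<le> d * ln (2 * real n + 1) / r"
      using lnV r(1) by (intro divide_right_mono) auto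
    ultimately have 1: "(\<Sum>i<n. (g a (fst (f i)) - g a (snd (f i))) / 2)
        \<ge> - r * n - d * ln (2 * real n + 1) / r"
      by linarith
    have "sum_list (map (g a) ps) = (\<Sum>i<n. g a (us ! i)) + (\<Sum>i<n. g a (vs ! i))"
    proof -
      have "sum_list (map (g a) ps) = sum_list (map (g a) us) + sum_list (map (g a) vs)"
        by (simp add: uv(1))
      then show ?thesis using uv(2,3) by (simp add: sum_list_sum_nth atLeast0LessThan)
    qed
    also have "\<dots> = (\<Sum>i<n. g a (fst (f i)) + g a (snd (f i)))"
      unfolding sum.distrib[symmetric] using f(1)
      by (intro sum.cong refl) (fastforce simp: Opt_def split: if_splits)
    finally have 2: "sum_list (map (g a) ps) = (\<Sum>i<n. g a (fst (f i)) + g a (snd (f i)))" .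
    have "sum_list (map (g a) qs) = (\<Sum>i<n. g a (fst (f i)))"
      by (simp add: qs_def sum_list_sum_nth atLeast0LessThan)
    also have "\<dots> = (\<Sum>i<n. (g a (fst (f i)) + g a (snd (f i))) / 2
         + (g a (fst (f i)) - g a (snd (f i))) / 2)"
      by (intro sum.cong) (auto simp: field_simps)
    also have "\<dots> = sum_list (map (g a) ps) / 2 + (\<Sum>i<n. (g a (fst (f i)) - g a (snd (f i))) / 2)"
      unfolding 2 sum_divide_distrib by (rule sum.distrib)
    also have "\<dots> \<ge> sum_list (map (g a) ps) / 2 - r * n - d * ln (2 * real n + 1) / r"
      using 1 by simp
    finally have "(sum_list (map (g a) ps) / 2 - r * n - d * ln (2 * real n + 1) / r) / n
       \<le> sum_list (map (g a) qs) / n"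
      by (intro divide_right_mono) auto
    then show ?thesis using n by (simp add: mean_def ps(2) qs_def diff_divide_distrib mult.commute)
  qed
  note mean_qs = this
  have "set qs \<subseteq> P" "length qs = n" using fmem ps(1) by (auto simp: qs_def)
  then show ?thesis by (intro exI[of _ qs] conjI ballI mean_qs)
qed

text \<open>A bound for the loss in \<open>halving\<close> at \<open>n = 2 ^ j\<close> with the choice \<open>r = (2/3) ^ j\<close>, which
makes both error terms summable in \<open>j\<close>.\<close>

definition halving_loss :: "nat \<Rightarrow> nat \<Rightarrow> real" where
  "halving_loss d j = (2/3) ^ j + d * (real (Suc j) * (3/4) ^ j + (3/4) ^ j)"

lemma halving_loss_tail:
  assumes "0 < \<eta>"
  shows "\<exists>m. \<forall>k. (\<Sum>j=m..<k. halving_loss d j) < \<eta>"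
proof -
  have "summable (\<lambda>j. real (Suc j) * (3/4 :: real) ^ j)"
    using geometric_deriv_sums[of "3/4 :: real"] by (auto simp: sums_iff)
  then have "summable (halving_loss d)"
    unfolding halving_loss_def by (intro summable_add summable_mult summable_geometric) auto
  then obtain m where m: "\<And>k. norm (\<Sum>j=m..<k. halving_loss d j) < \<eta>"
    using assms unfolding summable_Cauchy by (meson order_refl)
  have "(\<Sum>j=m..<k. halving_loss d j) < \<eta>" for k using m[of k] by simp
  then show ?thesis by blast
qed

text \<open>The final length \<open>2 ^ m\<close> and the total loss, which is a piece of a convergent series, do not
depend on the initial length.\<close>

lemma repeated_halving:
  assumes A: "finite A" "A \<noteq> {}" and bd: "\<And>a p. a \<in> A \<Longrightarrow> p \<in> P \<Longrightarrow> \<bar>g a p\<bar> \<le> (1::real)"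
    and gr: "poly_growth d g A P"
    and ps: "set ps \<subseteq> P" "length ps = 2 ^ (m + k)"
  shows "\<exists>qs. set qs \<subseteq> P \<and> length qs = 2 ^ m \<and>
    (\<forall>a\<in>A. mean (g a) qs \<ge> mean (g a) ps - (\<Sum>j=m..<m+k. halving_loss d j))"
  using ps
proof (induction k arbitrary: ps)
  case 0
  then show ?case by (intro exI[of _ ps]) auto
next
  case (Suc k)
  define j where "j = m + k"
  have len: "length ps = 2 * 2 ^ j" using Suc.prems by (simp add: j_def)
  obtain qs where qs: "set qs \<subseteq> P" "length qs = 2 ^ j"
    "\<forall>a\<in>A. mean (g a) qs \<ge> mean (g a) ps - (2/3) ^ j - d * ln (2 * (2 ^ j :: nat) + 1) / ((2 ^ j :: nat) * (2/3) ^ j)"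
    using halving[OF A bd gr Suc.prems(1) len, of "(2/3) ^ j"]
    by (auto simp: power_le_one add.commute)
  have "(1::real) \<le> 2 ^ j" "(2::real) ^ (j + 2) = 4 * 2 ^ j" by simp_all
  then have "(2::real) * 2 ^ j + 1 \<le> 2 ^ (j + 2)" by linarith
  also have "\<dots> \<le> exp 1 ^ (j + 2)"
    using exp_ge_add_one_self[of 1] by (intro power_mono) auto
  also have "\<dots> = exp (real (j + 2))" by (metis exp_of_nat_mult mult.right_neutral)
  finally have "ln ((2::real) * 2 ^ j + 1) \<le> ln (exp (real (j + 2)))"
    by (intro ln_mono) (auto intro: add_pos_pos)
  then have ln: "ln ((2::real) * 2 ^ j + 1) \<le> j + 2" by simp
  have "(2 ^ j) * (2/3 :: real) ^ j = (4/3) ^ j"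
    by (simp add: power_mult_distrib[symmetric])
  then have "d * ln (2 * (2 ^ j :: nat) + 1) / ((2 ^ j :: nat) * (2/3) ^ j)
      = d * (ln ((2::real) * 2 ^ j + 1) * (3/4) ^ j)"
    by (simp add: power_divide field_simps)
  also have "\<dots> \<le> d * ((j + 2) * (3/4) ^ j)"
    using ln by (intro mult_left_mono mult_right_mono) auto
  also have "\<dots> = d * (real (Suc j) * (3/4) ^ j + (3/4) ^ j)"
    by (simp add: algebra_simps)
  finally have e: "(2/3) ^ j + d * ln (2 * (2 ^ j :: nat) + 1) / ((2 ^ j :: nat) * (2/3) ^ j) \<le> halving_loss d j"
    by (simp add: halving_loss_def)
  obtain rs where rs: "set rs \<subseteq> P" "length rs = 2 ^ m"
    "\<forall>a\<in>A. mean (g a) rs \<ge> mean (g a) qs - (\<Sum>j=m..<m+k. halving_loss d j)"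
    using Suc.IH[of qs] qs by (auto simp: j_def)
  have "mean (g a) rs \<ge> mean (g a) ps - (\<Sum>j=m..<m+Suc k. halving_loss d j)" if "a \<in> A" for a
  proof -
    have "(\<Sum>j=m..<m+Suc k. halving_loss d j) = (\<Sum>j=m..<m+k. halving_loss d j) + halving_loss d j"
      by (simp add: j_def)
    then show ?thesis using rs(3) qs(3) e that by fastforce
  qed
  with rs show ?case by blast
qed

section \<open>Points against signed instances\<close>

text \<open>The payoff to the point \<open>a\<close> of the signed instance \<open>p = (b, s)\<close>, where \<open>s\<close> is meant to be
\<open>1\<close> or \<open>-1\<close>. The sign encodes whether the average over the points is too low or too high at
\<open>b\<close>.\<close>

definition deviation :: "('b \<Rightarrow> real) \<Rightarrow> ('a \<Rightarrow> 'b \<Rightarrow> bool) \<Rightarrow> 'a \<Rightarrow> 'b \<times> real \<Rightarrow> real" where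
  "deviation F E a p = snd p * (F (fst p) - of_bool (E a (fst p)))"

lemma abs_deviation_le:
  assumes "p \<in> Y \<times> {1, -1}" "F ` Y \<subseteq> {0..1}"
  shows "\<bar>deviation F E a p\<bar> \<le> 1"
proof -
  have "0 \<le> F (fst p)" "F (fst p) \<le> 1" using assms by force+
  then show ?thesis using assms(1) by (auto simp: deviation_def)
qed

text \<open>The deviation depends on \<open>a\<close> only through the set of instances that \<open>a\<close> satisfies, so
Sauer--Shelah bounds the number of its shapes.\<close>

lemma poly_growth_deviation:
  fixes F :: "'b \<Rightarrow> real" and E :: "'a \<Rightarrow> 'b \<Rightarrow> bool"
  assumes vc: "\<And>S. finite S \<Longrightarrow> S \<subseteq> Y \<Longrightarrow> shatters ((\<lambda>a. {b\<in>S. E a b}) ` A) S \<Longrightarrow> card S \<le> d"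
  shows "poly_growth d (deviation F E) A (Y \<times> {1, -1})"
  unfolding poly_growth_def
proof (intro allI impI)
  fix ps :: "('b \<times> real) list" assume ps: "set ps \<subseteq> Y \<times> {1, -1}"
  define X where "X = fst ` set ps"
  define Tr where "Tr = (\<lambda>a. {b\<in>X. E a b}) ` A"
  have X: "finite X" "X \<subseteq> Y" using ps by (auto simp: X_def)
  have "(\<lambda>a. restrict (deviation F E a) (set ps)) ` A
      = (\<lambda>T. restrict (deviation F (\<lambda>_ b. b \<in> T) undefined) (set ps)) ` Tr"
    unfolding Tr_def image_image
    by (intro image_cong refl restrict_ext) (auto simp: deviation_def X_def)
  moreover have "finite Tr" using X(1) by (auto simp: Tr_def intro: finite_subset[of _ "Pow X"])
  ultimately have "card ((\<lambda>a. restrict (deviation F E a) (set ps)) ` A) \<le> card Tr"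
    by (metis card_image_le)
  also have "\<dots> \<le> (card X + 1) ^ d"
  proof (rule sauer_shelah[OF X(1)])
    show "Tr \<subseteq> Pow X" by (auto simp: Tr_def)
    fix S assume S: "S \<subseteq> X" "shatters Tr S"
    have "{b\<in>X. E a b} \<inter> S = {b\<in>S. E a b} \<inter> S" for a using S(1) by blast
    then have "shatters ((\<lambda>a. {b\<in>S. E a b}) ` A) S"
      using S(2) by (simp add: shatters_def Tr_def)
    moreover have "finite S" "S \<subseteq> Y" using S(1) X finite_subset[of S X] by auto
    ultimately show "card S \<le> d" by (intro vc)
  qed
  also have "\<dots> \<le> (length ps + 1) ^ d"
    unfolding X_def by (intro power_mono add_mono) (meson card_image_le card_length finite_set le_trans, auto)
  finally show "card ((\<lambda>a. restrict (deviation F E a) (set ps)) ` A) \<le> (length ps + 1) ^ d" .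
qed

text \<open>The hypothesis speaks of averages over lists, whereas \<open>multiplicative_weights\<close> asks about
real weights. Scale the weights up and round them to multiplicities: the error is at most
one for each element of \<open>A\<close>, and a large scaling factor makes it half of the scaled
deviation.\<close>

lemma weighted_deviation:
  assumes A: "finite A" "A \<noteq> {}" and \<epsilon>: "0 < \<epsilon>"
    and bad: "\<And>as. as \<noteq> [] \<Longrightarrow> set as \<subseteq> A \<Longrightarrow>
       \<exists>b\<in>Y. \<bar>F b - mean (\<lambda>a. of_bool (E a b)) as\<bar> \<ge> \<epsilon>"
    and F: "F ` Y \<subseteq> {0..1}" and W: "\<And>a. a \<in> A \<Longrightarrow> 0 < W a"
  shows "\<exists>p\<in>Y \<times> {1, -1}. (\<Sum>a\<in>A. W a * deviation F E a p) \<ge> \<epsilon> / 2 * (\<Sum>a\<in>A. W a)"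
proof -
  define S where "S = (\<Sum>a\<in>A. W a)"
  have S: "0 < S" unfolding S_def using A W by (intro sum_pos)
  \<comment> \<open>With this scaling the total rounding error \<open>card A\<close> is half of the scaled
    deviation \<open>\<epsilon> * K * S\<close>.\<close>
  define K where "K = card A / (\<epsilon> / 2 * S)"
  have K: "0 < K" using A S \<epsilon> by (simp add: K_def card_gt_0_iff)
  define n where "n a = nat \<lceil>K * W a\<rceil>" for a
  have n: "K * W a \<le> n a" "n a \<le> K * W a + 1" if "a \<in> A" for a
  proof -
    have "0 \<le> K * W a" using K W[OF that] by simp
    then show "K * W a \<le> n a" "n a \<le> K * W a + 1" unfolding n_def by linarith+
  qed
  obtain xs where xs: "set xs = A" "distinct xs" using finite_distinct_list[OF A(1)] by blast
  define as where "as = concat (map (\<lambda>a. replicate (n a) a) xs)"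
  have sum_as: "sum_list (map f as) = (\<Sum>a\<in>A. n a * f a)" for f :: "'a \<Rightarrow> real"
  proof -
    have "sum_list (map f as) = sum_list (map (\<lambda>a. n a * f a) xs)"
      unfolding as_def by (induction xs) (auto simp: sum_list_replicate)
    then show ?thesis using xs by (simp add: sum_list_distinct_conv_sum_set)
  qed
  have len: "real (length as) = (\<Sum>a\<in>A. n a)"
    using sum_as[of "\<lambda>_. 1"] by (simp add: sum_list_triv)
  have "0 < (\<Sum>a\<in>A. n a)"
  proof (rule sum_pos[OF A])
    fix a assume "a \<in> A"
    then have "0 < K * W a" using K W by simp
    then show "0 < n a" by (simp add: n_def)
  qed
  then have len0: "0 < real (length as)" unfolding len by (simp flip: of_nat_sum)
  then have "as \<noteq> []" by auto
  moreover have "set as \<subseteq> A" using xs by (auto simp: as_def)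
  ultimately obtain b where b: "b \<in> Y" "\<bar>F b - mean (\<lambda>a. of_bool (E a b)) as\<bar> \<ge> \<epsilon>"
    using bad by blast
  obtain s :: real where s: "s \<in> {1, -1}" "s * (F b - mean (\<lambda>a. of_bool (E a b)) as) \<ge> \<epsilon>"
  proof (cases "F b - mean (\<lambda>a. of_bool (E a b)) as \<ge> 0")
    case True
    then show ?thesis using b(2) that[of 1] by simp
  next
    case False
    then show ?thesis using b(2) that[of "-1"] by simp
  qed
  define h where "h a = deviation F E a (b, s)" for a
  have p: "(b, s) \<in> Y \<times> {1, -1}" using b(1) s(1) by simp
  have h: "\<bar>h a\<bar> \<le> 1" for a unfolding h_def using p F by (rule abs_deviation_le)
  have "(\<Sum>a\<in>A. n a * h a) = s * (F b * (\<Sum>a\<in>A. n a) - (\<Sum>a\<in>A. n a * of_bool (E a b)))"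
    by (simp add: h_def deviation_def sum_distrib_left sum_subtractf algebra_simps)
  also have "\<dots> = (s * (F b - mean (\<lambda>a. of_bool (E a b)) as)) * length as"
    using len0 unfolding mean_def sum_as len[symmetric] by (simp add: field_simps)
  also have "\<dots> \<ge> \<epsilon> * length as"
    using s(2) by (intro mult_right_mono) auto
  also have "real (length as) = (\<Sum>a\<in>A. n a)" by (rule len)
  finally have 1: "\<epsilon> * (\<Sum>a\<in>A. n a) \<le> (\<Sum>a\<in>A. n a * h a)" .
  have "K * S \<le> (\<Sum>a\<in>A. n a)"
    using n(1) by (auto simp: S_def sum_distrib_left intro: sum_mono)
  then have "\<epsilon> * (K * S) \<le> \<epsilon> * (\<Sum>a\<in>A. n a)" using \<epsilon> by simp
  also note 1
  also have "(\<Sum>a\<in>A. n a * h a) \<le> (\<Sum>a\<in>A. K * (W a * h a) + 1)"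
  proof (rule sum_mono)
    fix a assume a: "a \<in> A"
    have "(n a - K * W a) * h a \<le> \<bar>n a - K * W a\<bar> * \<bar>h a\<bar>"
      by (metis abs_ge_self abs_mult)
    also have "\<dots> \<le> 1 * 1" using n[OF a] h[of a] by (intro mult_mono) auto
    finally show "n a * h a \<le> K * (W a * h a) + 1" by (simp add: algebra_simps)
  qed
  also have "\<dots> = K * (\<Sum>a\<in>A. W a * h a) + card A"
    by (simp add: sum.distrib sum_distrib_left)
  also have "card A = K * (\<epsilon> / 2 * S)" using S \<epsilon> by (simp add: K_def)
  finally have "K * (\<epsilon> / 2 * S) \<le> K * (\<Sum>a\<in>A. W a * h a)" by (simp add: algebra_simps)
  then have "\<epsilon> / 2 * S \<le> (\<Sum>a\<in>A. W a * h a)" using K by simp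
  then show ?thesis using p unfolding h_def S_def by blast
qed

text \<open>First a long list from \<open>multiplicative_weights\<close>, with mean deviation at least \<open>\<epsilon>/8\<close> on \<open>A\<close>,
then halving at the cost of at most \<open>\<epsilon>/16\<close>. The point is the order of the quantifiers: \<open>N\<close>
comes before \<open>A\<close>.\<close>

lemma bounded_deviation_sample:
  fixes F :: "'b \<Rightarrow> real" and E :: "'a \<Rightarrow> 'b \<Rightarrow> bool"
  assumes \<epsilon>: "0 < \<epsilon>" "\<epsilon> \<le> 1" and F: "F ` Y \<subseteq> {0..1}"
    and bad: "\<And>as. as \<noteq> [] \<Longrightarrow> set as \<subseteq> X \<Longrightarrow>
       \<exists>b\<in>Y. \<bar>F b - mean (\<lambda>a. of_bool (E a b)) as\<bar> \<ge> \<epsilon>"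
    and vc: "\<And>S. finite S \<Longrightarrow> S \<subseteq> Y \<Longrightarrow> shatters ((\<lambda>a. {b\<in>S. E a b}) ` X) S \<Longrightarrow> card S \<le> d"
  shows "\<exists>N>0. \<forall>A. finite A \<longrightarrow> A \<noteq> {} \<longrightarrow> A \<subseteq> X \<longrightarrow>
     (\<exists>qs. set qs \<subseteq> Y \<times> {1, -1} \<and> length qs = N \<and> (\<forall>a\<in>A. mean (deviation F E a) qs \<ge> \<epsilon> / 16))"
proof -
  have "0 < \<epsilon> / 16" using \<epsilon> by simp
  then obtain m where m: "\<And>k. (\<Sum>j=m..<k. halving_loss d j) < \<epsilon> / 16"
    using halving_loss_tail by blast
  have "\<exists>qs. set qs \<subseteq> Y \<times> {1, -1} \<and> length qs = 2 ^ m \<and> (\<forall>a\<in>A. mean (deviation F E a) qs \<ge> \<epsilon> / 16)"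
    if A: "finite A" "A \<noteq> {}" "A \<subseteq> X" for A
  proof -
    let ?P = "Y \<times> {1, -1 :: real}"
    \<comment> \<open>With rate \<open>\<epsilon>/4\<close> the guaranteed mean is \<open>\<epsilon>/4\<close> minus a term that is at most
      \<open>\<epsilon>/8\<close> for lists this long.\<close>
    obtain k where k: "ln (card A) * 32 / \<epsilon>\<^sup>2 < 2 ^ k"
      using real_arch_pow[of 2 "ln (card A) * 32 / \<epsilon>\<^sup>2"] by auto
    define n :: nat where "n = 2 ^ (m + k)"
    have "ln (card A) * 32 / \<epsilon>\<^sup>2 \<le> n"
    proof -
      have "(2::real) ^ k \<le> 2 ^ (m + k)" by (intro power_increasing) auto
      with k have "ln (card A) * 32 / \<epsilon>\<^sup>2 \<le> 2 ^ (m + k)" by linarith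
      then show ?thesis by (simp add: n_def)
    qed
    then have n: "ln (card A) / (\<epsilon> / 4) \<le> \<epsilon> / 8 * n"
      using \<epsilon>(1) by (simp add: field_simps power2_eq_square)
    have bd: "\<bar>deviation F E a p\<bar> \<le> 1" if "p \<in> ?P" for a p
      using that F by (rule abs_deviation_le)
    have opt: "\<exists>p\<in>?P. (\<Sum>a\<in>A. W a * deviation F E a p) \<ge> \<epsilon> / 2 * (\<Sum>a\<in>A. W a)"
      if "\<And>a. a \<in> A \<Longrightarrow> 0 < W a" for W
      using A(1,2) \<epsilon>(1) _ F that by (rule weighted_deviation) (use bad A(3) in auto)
    have "0 < \<epsilon> / 4" "\<epsilon> / 4 \<le> 1" using \<epsilon> by auto
    from multiplicative_weights[OF A(1,2) this, where Opt = "\<lambda>_. ?P" and h = "deviation F E" and c = "\<epsilon> / 2" and n = n,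
        OF bd opt]
    obtain f where f: "\<forall>i<n. f i \<in> ?P"
      "\<forall>a\<in>A. (\<Sum>i<n. deviation F E a (f i)) \<ge> (\<epsilon> / 2 - \<epsilon> / 4) * n - ln (card A) / (\<epsilon> / 4)"
      by blast
    define ps where "ps = map f [0..<n]"
    have ps: "set ps \<subseteq> ?P" "length ps = 2 ^ (m + k)" using f(1) by (auto simp: ps_def n_def)
    have mean_ps: "mean (deviation F E a) ps \<ge> \<epsilon> / 8" if "a \<in> A" for a
    proof -
      have "sum_list (map (deviation F E a) ps) = (\<Sum>i<n. deviation F E a (f i))"
        by (simp add: ps_def sum_list_sum_nth atLeast0LessThan)
      also have "\<dots> \<ge> \<epsilon> / 8 * n" using f(2) n that by fastforce
      finally show ?thesis by (simp add: mean_def ps_def n_def le_divide_eq)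
    qed
    have gr: "poly_growth d (deviation F E) A ?P"
    proof (rule poly_growth_deviation)
      fix S assume S: "finite S" "S \<subseteq> Y" "shatters ((\<lambda>a. {b\<in>S. E a b}) ` A) S"
      have "shatters G S" if "shatters H S" "H \<subseteq> G" for G H
        using that unfolding shatters_def by (meson subsetD)
      from this[OF S(3)] have "shatters ((\<lambda>a. {b\<in>S. E a b}) ` X) S"
        using A(3) by (simp add: image_mono)
      then show "card S \<le> d" by (rule vc[OF S(1,2)])
    qed
    have "\<exists>qs. set qs \<subseteq> ?P \<and> length qs = 2 ^ m \<and> (\<forall>a\<in>A. mean (deviation F E a) qs
         \<ge> mean (deviation F E a) ps - (\<Sum>j=m..<m+k. halving_loss d j))"
      using A(1,2) bd gr ps by (rule repeated_halving)
    then obtain qs where qs: "set qs \<subseteq> ?P" "length qs = 2 ^ m"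
      "\<forall>a\<in>A. mean (deviation F E a) qs
         \<ge> mean (deviation F E a) ps - (\<Sum>j=m..<m+k. halving_loss d j)"
      by blast
    have "mean (deviation F E a) qs \<ge> \<epsilon> / 16" if "a \<in> A" for a
      using qs(3)[rule_format, OF that] mean_ps[OF that] m[of "m + k"] by linarith
    with qs(1,2) show ?thesis by blast
  qed
  then show ?thesis by (intro exI[of _ "2 ^ m"]) simp
qed

section \<open>Substitution and definable predicates\<close>

lemma eval_trm_cong: "(\<And>v. v \<in> fv_trm t \<Longrightarrow> e v = e' v) \<Longrightarrow> eval_trm U e t = eval_trm U e' t"
proof (induction t)
  case (App f ts)
  then have "map (eval_trm U e) ts = map (eval_trm U e') ts" by (intro map_cong) auto
  then show ?case by (simp only: eval_trm.simps)
qed simp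

lemma sat_cong: "(\<And>v. v \<in> fv p \<Longrightarrow> e v = e' v) \<Longrightarrow> sat U e p \<longleftrightarrow> sat U e' p"
proof (induction p arbitrary: e e')
  case (Eq s t)
  have "eval_trm U e s = eval_trm U e' s" "eval_trm U e t = eval_trm U e' t"
    by (rule eval_trm_cong, simp add: Eq)+
  then show ?case by (simp only: sat.simps)
next
  case (Rel r ts)
  then have "map (eval_trm U e) ts = map (eval_trm U e') ts"
    by (intro map_cong refl eval_trm_cong) auto
  then show ?case by (simp only: sat.simps)
next
  case (Neg p)
  have "sat U e p \<longleftrightarrow> sat U e' p" by (rule Neg.IH) (simp add: Neg.prems)
  then show ?case by (simp only: sat.simps)
next
  case (Conj p q)
  have "sat U e p \<longleftrightarrow> sat U e' p" by (rule Conj.IH) (simp add: Conj.prems)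
  moreover have "sat U e q \<longleftrightarrow> sat U e' q" by (rule Conj.IH) (simp add: Conj.prems)
  ultimately show ?case by (simp only: sat.simps)
next
  case (Exists v p)
  have "sat U (e(v := c)) p \<longleftrightarrow> sat U (e'(v := c)) p" for c
    by (rule Exists.IH) (simp add: Exists.prems)
  then show ?case by (simp only: sat.simps)
qed

lemma finite_fv_trm: "finite (fv_trm t)"
  by (induction t) auto

lemma finite_fv: "finite (fv p)"
  by (induction p) (auto simp: finite_fv_trm)

primrec subst_trm :: "(nat \<Rightarrow> 'f trm) \<Rightarrow> 'f trm \<Rightarrow> 'f trm" where
  "subst_trm \<sigma> (Var v) = \<sigma> v"
| "subst_trm \<sigma> (App f ts) = App f (map (subst_trm \<sigma>) ts)"

lemma eval_subst_trm: "eval_trm U e (subst_trm \<sigma> t) = eval_trm U (\<lambda>v. eval_trm U e (\<sigma> v)) t"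
proof (induction t)
  case (App f ts)
  then have "map (\<lambda>t. eval_trm U e (subst_trm \<sigma> t)) ts
      = map (eval_trm U (\<lambda>v. eval_trm U e (\<sigma> v))) ts"
    by (intro map_cong) auto
  then show ?case by (simp only: subst_trm.simps eval_trm.simps map_map o_def)
qed simp

lemma fv_subst_trm: "fv_trm (subst_trm \<sigma> t) = (\<Union>v\<in>fv_trm t. fv_trm (\<sigma> v))"
  by (induction t) auto

lemma wf_subst_trm:
  "wf_trm L t \<Longrightarrow> (\<And>v. v \<in> fv_trm t \<Longrightarrow> wf_trm L (\<sigma> v)) \<Longrightarrow> wf_trm L (subst_trm \<sigma> t)"
  by (induction t) (auto simp: list_all_iff)

text \<open>Formulas carry named bound variables, so a bound variable is replaced by a fresh one to
avoid capture. Only the existence of some formula with the right meaning is needed, which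
saves a recursive definition of capture-avoiding substitution.\<close>

lemma substitution:
  assumes "wf_fm L p" "\<And>v. v \<in> fv p \<Longrightarrow> wf_trm L (\<sigma> v)"
  shows "\<exists>q. wf_fm L q \<and> fv q \<subseteq> (\<Union>v\<in>fv p. fv_trm (\<sigma> v)) \<and>
           (\<forall>e. sat U e q \<longleftrightarrow> sat U (\<lambda>v. eval_trm U e (\<sigma> v)) p)"
  using assms
proof (induction p arbitrary: \<sigma>)
  case (Eq s t)
  then show ?case
    by (intro exI[of _ "Eq (subst_trm \<sigma> s) (subst_trm \<sigma> t)"])
      (auto simp: eval_subst_trm fv_subst_trm wf_subst_trm)
next
  case (Rel r ts)
  then show ?case
    by (intro exI[of _ "Rel r (map (subst_trm \<sigma>) ts)"])
      (auto simp: eval_subst_trm fv_subst_trm list_all_iff o_def intro!: wf_subst_trm)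
next
  case (Neg p)
  obtain q where "wf_fm L q" "fv q \<subseteq> (\<Union>v\<in>fv p. fv_trm (\<sigma> v))"
    "\<forall>e. sat U e q \<longleftrightarrow> sat U (\<lambda>v. eval_trm U e (\<sigma> v)) p"
    using Neg.IH[of \<sigma>] Neg.prems unfolding wf_fm.simps fv.simps by blast
  then show ?case by (intro exI[of _ "Neg q"]) auto
next
  case (Conj p1 p2)
  obtain q1 where "wf_fm L q1" "fv q1 \<subseteq> (\<Union>v\<in>fv p1. fv_trm (\<sigma> v))"
    "\<forall>e. sat U e q1 \<longleftrightarrow> sat U (\<lambda>v. eval_trm U e (\<sigma> v)) p1"
    using Conj.IH(1)[of \<sigma>] Conj.prems unfolding wf_fm.simps fv.simps by blast
  moreover obtain q2 where "wf_fm L q2" "fv q2 \<subseteq> (\<Union>v\<in>fv p2. fv_trm (\<sigma> v))"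
    "\<forall>e. sat U e q2 \<longleftrightarrow> sat U (\<lambda>v. eval_trm U e (\<sigma> v)) p2"
    using Conj.IH(2)[of \<sigma>] Conj.prems unfolding wf_fm.simps fv.simps by blast
  ultimately show ?case by (intro exI[of _ "Conj q1 q2"]) auto
next
  case (Exists u p)
  let ?used = "\<Union>v\<in>fv p. fv_trm (\<sigma> v)"
  have "finite ?used" by (simp add: finite_fv finite_fv_trm)
  then obtain w where w: "w \<notin> ?used" using infinite_UNIV_nat ex_new_if_finite by blast
  define \<tau> where "\<tau> = \<sigma>(u := Var w)"
  obtain q where q: "wf_fm L q" "fv q \<subseteq> (\<Union>v\<in>fv p. fv_trm (\<tau> v))"
    "\<forall>e. sat U e q \<longleftrightarrow> sat U (\<lambda>v. eval_trm U e (\<tau> v)) p"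
  proof -
    have "wf_fm L p" "\<And>v. v \<in> fv p \<Longrightarrow> wf_trm L (\<tau> v)" using Exists.prems by (auto simp: \<tau>_def)
    then have "\<exists>q. wf_fm L q \<and> fv q \<subseteq> (\<Union>v\<in>fv p. fv_trm (\<tau> v)) \<and>
        (\<forall>e. sat U e q \<longleftrightarrow> sat U (\<lambda>v. eval_trm U e (\<tau> v)) p)"
      by (rule Exists.IH)
    with that show thesis by blast
  qed
  have "sat U (e(w := c)) q \<longleftrightarrow> sat U ((\<lambda>v. eval_trm U e (\<sigma> v))(u := c)) p" for e c
  proof -
    have "eval_trm U (e(w := c)) (\<tau> v) = ((\<lambda>v. eval_trm U e (\<sigma> v))(u := c)) v" if "v \<in> fv p" for v
    proof (cases "v = u")
      case False
      have "eval_trm U (e(w := c)) (\<sigma> v) = eval_trm U e (\<sigma> v)"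
        using w that by (intro eval_trm_cong) auto
      with False show ?thesis by (simp add: \<tau>_def)
    qed (simp add: \<tau>_def)
    then have "sat U (\<lambda>v. eval_trm U (e(w := c)) (\<tau> v)) p
        \<longleftrightarrow> sat U ((\<lambda>v. eval_trm U e (\<sigma> v))(u := c)) p"
      by (intro sat_cong) auto
    with q(3) show ?thesis by simp
  qed
  then show ?case
    using q(1,2) by (intro exI[of _ "Exists w q"]) (auto simp: \<tau>_def split: if_splits)
qed

text \<open>Predicates on assignments that are given by a formula over \<open>A\<close> with free variables in \<open>z\<close>.
Working with them instead of formulas keeps the syntax out of the later arguments.\<close>

definition definable :: "('f, 'r) lang \<Rightarrow> ('f, 'r, 'a) fo_struct \<Rightarrow> 'a set \<Rightarrow> nat set \<Rightarrow>
    ((nat \<Rightarrow> 'a) \<Rightarrow> bool) \<Rightarrow> bool" where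
  "definable L U A z Q \<longleftrightarrow> (\<exists>\<psi>\<in>fmls (param_lang L A) z.
     \<forall>e. e ` z \<subseteq> univ U \<longrightarrow> (Q e \<longleftrightarrow> sat (with_params U) e \<psi>))"

lemma definable_not: "definable L U A z Q \<Longrightarrow> definable L U A z (\<lambda>e. \<not> Q e)"
  unfolding definable_def
  by (elim bexE, rule_tac x = "Neg \<psi>" in bexI) (auto simp: fmls_def)

lemma definable_conj:
  assumes "definable L U A z Q" "definable L U A z R"
  shows "definable L U A z (\<lambda>e. Q e \<and> R e)"
proof -
  obtain p q where "p \<in> fmls (param_lang L A) z" "\<forall>e. e ` z \<subseteq> univ U \<longrightarrow> (Q e \<longleftrightarrow> sat (with_params U) e p)"
    "q \<in> fmls (param_lang L A) z" "\<forall>e. e ` z \<subseteq> univ U \<longrightarrow> (R e \<longleftrightarrow> sat (with_params U) e q)"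
    using assms unfolding definable_def by blast
  then show ?thesis unfolding definable_def
    by (intro bexI[of _ "Conj p q"]) (auto simp: fmls_def)
qed

lemma definable_True: "definable L U A z (\<lambda>_. True)"
  unfolding definable_def
  by (intro bexI[of _ "Neg (Exists 0 (Neg (Eq (Var 0) (Var 0))))"]) (auto simp: fmls_def)

lemma definable_finite_ball:
  assumes "finite J" "\<And>j. j \<in> J \<Longrightarrow> definable L U A z (Q j)"
  shows "definable L U A z (\<lambda>e. \<forall>j\<in>J. Q j e)"
  using assms
proof (induction J rule: finite_induct)
  case empty
  then show ?case using definable_True by simp
next
  case (insert j J)
  then show ?case using definable_conj[of L U A z "Q j" "\<lambda>e. \<forall>j\<in>J. Q j e"] by simp
qed

lemma definable_ex:
  assumes "definable L U A (insert v z) Q"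
  shows "definable L U A z (\<lambda>e. \<exists>c\<in>univ U. Q (e(v := c)))"
proof -
  obtain p where p: "p \<in> fmls (param_lang L A) (insert v z)"
    "\<forall>e. e ` insert v z \<subseteq> univ U \<longrightarrow> (Q e \<longleftrightarrow> sat (with_params U) e p)"
    using assms unfolding definable_def by blast
  have "(\<exists>c\<in>univ U. Q (e(v := c))) \<longleftrightarrow> sat (with_params U) e (Exists v p)"
    if "e ` z \<subseteq> univ U" for e
  proof -
    have "(e(v := c)) ` insert v z \<subseteq> univ U" if "c \<in> univ U" for c
      using that \<open>e ` z \<subseteq> univ U\<close> by auto
    with p(2) have "Q (e(v := c)) \<longleftrightarrow> sat (with_params U) (e(v := c)) p" if "c \<in> univ U" for c
      using that by blast
    moreover have "univ (with_params U) = univ U" by (simp add: with_params_def)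
    ultimately show ?thesis by simp
  qed
  then show ?thesis
    unfolding definable_def using p(1) by (intro bexI[of _ "Exists v p"]) (auto simp: fmls_def)
qed

lemma definable_ex_finite:
  assumes "finite W" "definable L U A (W \<union> z) Q"
    and "\<And>e e'. (\<And>v. v \<in> W \<union> z \<Longrightarrow> e v = e' v) \<Longrightarrow> Q e = Q e'"
  shows "definable L U A z (\<lambda>e. \<exists>c. c ` W \<subseteq> univ U \<and> Q (override_on e c W))"
  using assms
proof (induction W arbitrary: Q rule: finite_induct)
  case empty
  show ?case using empty.prems(1) by simp
next
  case (insert w W)
  define R where "R e \<longleftrightarrow> (\<exists>d\<in>univ U. Q (e(w := d)))" for e
  have "definable L U A (W \<union> z) R"
    unfolding R_def using insert.prems(1) by (intro definable_ex) simp
  moreover have "R e = R e'" if "\<And>v. v \<in> W \<union> z \<Longrightarrow> e v = e' v" for e e'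
  proof -
    have "Q (e(w := d)) = Q (e'(w := d))" for d
      using that by (intro insert.prems(2)) auto
    then show ?thesis by (simp add: R_def)
  qed
  ultimately have "definable L U A z (\<lambda>e. \<exists>c. c ` W \<subseteq> univ U \<and> R (override_on e c W))"
    by (rule insert.IH)
  moreover have "(\<exists>c. c ` W \<subseteq> univ U \<and> R (override_on e c W)) \<longleftrightarrow>
     (\<exists>c. c ` insert w W \<subseteq> univ U \<and> Q (override_on e c (insert w W)))" for e
  proof
    assume "\<exists>c. c ` W \<subseteq> univ U \<and> R (override_on e c W)"
    then obtain c d where c: "c ` W \<subseteq> univ U" "d \<in> univ U" "Q ((override_on e c W)(w := d))"
      by (auto simp: R_def)
    have "(override_on e c W)(w := d) = override_on e (c(w := d)) (insert w W)"
      using insert.hyps(2) by (auto simp: override_on_def)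
    with c insert.hyps(2) show "\<exists>c. c ` insert w W \<subseteq> univ U \<and> Q (override_on e c (insert w W))"
      by (intro exI[of _ "c(w := d)"]) auto
  next
    assume "\<exists>c. c ` insert w W \<subseteq> univ U \<and> Q (override_on e c (insert w W))"
    then obtain c where c: "c ` insert w W \<subseteq> univ U" "Q (override_on e c (insert w W))" by blast
    have "(override_on e c W)(w := c w) = override_on e c (insert w W)"
      by (auto simp: override_on_def)
    then have "R (override_on e c W)"
      unfolding R_def by (intro bexI[of _ "c w"]) (use c in \<open>simp_all del: override_on_insert\<close>)
    with c(1) show "\<exists>c. c ` W \<subseteq> univ U \<and> R (override_on e c W)" by blast
  qed
  ultimately show ?case by simp
qed

text \<open>Variables may be replaced by parameters (\<open>Inl\<close>) or renamed (\<open>Inr\<close>).\<close>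

lemma definable_subst:
  fixes \<sigma> :: "nat \<Rightarrow> 'a + nat"
  assumes "\<phi> \<in> fmls (param_lang L A) z" "A \<subseteq> B"
    "\<And>v. v \<in> z \<Longrightarrow> case \<sigma> v of Inl a \<Rightarrow> a \<in> B | Inr w \<Rightarrow> w \<in> z'"
  shows "definable L U B z' (\<lambda>e. sat (with_params U) (\<lambda>v. case_sum id e (\<sigma> v)) \<phi>)"
proof -
  define \<tau> :: "nat \<Rightarrow> ('b + 'a) trm" where
    "\<tau> v = (case \<sigma> v of Inl a \<Rightarrow> App (Inr a) [] | Inr w \<Rightarrow> Var w)" for v
  have wf_mono: "wf_trm (param_lang L B) t" if "wf_trm (param_lang L A) t" for t
    using that assms(2) by (induction t) (auto simp: param_lang_def list_all_iff)
  have wf: "wf_fm (param_lang L B) \<phi>"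
  proof -
    have "wf_fm (param_lang L B) p" if "wf_fm (param_lang L A) p" for p
      using that by (induction p) (auto simp: wf_mono list_all_iff, auto simp: param_lang_def)
    then show ?thesis using assms(1) by (simp add: fmls_def)
  qed
  have fv: "fv \<phi> \<subseteq> z" using assms(1) by (simp add: fmls_def)
  have "wf_trm (param_lang L B) (\<tau> v)" if "v \<in> fv \<phi>" for v
    using that fv assms(3)[of v] by (auto simp: \<tau>_def param_lang_def split: sum.splits)
  note substitution[OF wf, where \<sigma> = \<tau> and U = "with_params U"]
  with \<open>\<And>v. v \<in> fv \<phi> \<Longrightarrow> wf_trm (param_lang L B) (\<tau> v)\<close> obtain q where q: "wf_fm (param_lang L B) q" "fv q \<subseteq> (\<Union>v\<in>fv \<phi>. fv_trm (\<tau> v))"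
    "\<And>e. sat (with_params U) e q \<longleftrightarrow> sat (with_params U) (\<lambda>v. eval_trm (with_params U) e (\<tau> v)) \<phi>"
    by blast
  have "fv q \<subseteq> z'"
    using q(2) fv assms(3) by (fastforce simp: \<tau>_def split: sum.splits)
  moreover have "eval_trm (with_params U) e (\<tau> v) = case_sum id e (\<sigma> v)" for e v
    by (simp add: \<tau>_def with_params_def split: sum.splits)
  ultimately show ?thesis
    unfolding definable_def using q(1,3) by (intro bexI[of _ q]) (auto simp: fmls_def)
qed

section \<open>Saturation in countably many variables\<close>

lemma small_Un_countable:
  fixes A B :: "'c set"
  assumes "Card_order \<kappa>" "natLeq <o \<kappa>" "small \<kappa> A" "countable B"
  shows "small \<kappa> (A \<union> B)"
proof -
  obtain f :: "'c \<Rightarrow> nat" where "inj_on f B" using assms(4) unfolding countable_def by blast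
  then have "|B| \<le>o |UNIV :: nat set|" using card_of_ordLeq[of B "UNIV :: nat set"] by blast
  then have "|B| \<le>o natLeq" using card_of_nat ordLeq_ordIso_trans by blast
  then have "|B| <o \<kappa>" using assms(2) ordLeq_ordLess_trans by blast
  moreover have "infinite (Field \<kappa>)"
  proof -
    have "\<kappa> =o |Field \<kappa>|" using card_of_Field_ordIso[OF assms(1)] by (rule ordIso_symmetric)
    then have "natLeq \<le>o |Field \<kappa>|"
      by (rule ordLeq_ordIso_trans[OF ordLess_imp_ordLeq[OF assms(2)]])
    then show ?thesis using infinite_iff_natLeq_ordLeq by blast
  qed
  ultimately show ?thesis
    using assms(1,3) unfolding small_def by (intro card_of_Un_ordLess_infinite_Field)
qed

text \<open>Zorn's lemma, applied to the finitely satisfiable sets that contain \<open>p\<close>. In a maximal one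
\<open>q\<close>, if neither \<open>\<psi>\<close> nor its negation could be added, two finite subsets of \<open>q\<close> would exclude
\<open>\<psi>\<close> and its negation respectively, and their union would not be satisfiable.\<close>

lemma complete_type_extension:
  fixes p :: "('f + 'a, 'r) fm set"
  assumes p: "p \<subseteq> fmls (param_lang L A) z"
    and fin: "\<And>p0. finite p0 \<Longrightarrow> p0 \<subseteq> p \<Longrightarrow> \<exists>c\<in>tuples U z. \<forall>\<psi>\<in>p0. sat (with_params U) c \<psi>"
  shows "\<exists>q\<in>type_space L U A z. p \<subseteq> q"
proof -
  define fs where "fs q \<longleftrightarrow> (\<forall>p0. finite p0 \<longrightarrow> p0 \<subseteq> q \<longrightarrow> (\<exists>c\<in>tuples U z. \<forall>\<psi>\<in>p0. sat (with_params U) c \<psi>))"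
    for q :: "('f + 'a, 'r) fm set"
  define S where "S = {q. p \<subseteq> q \<and> q \<subseteq> fmls (param_lang L A) z \<and> fs q}"
  have "p \<in> S" using p fin by (auto simp: S_def fs_def)
  have "\<exists>q\<in>S. \<forall>X\<in>S. q \<subseteq> X \<longrightarrow> X = q"
  proof (rule subset_Zorn_nonempty)
    show "S \<noteq> {}" using \<open>p \<in> S\<close> by blast
    fix C assume C: "C \<noteq> {}" "subset.chain S C"
    have "fs (\<Union>C)" unfolding fs_def
    proof (intro allI impI)
      fix p0 assume "finite p0" "p0 \<subseteq> \<Union>C"
      then obtain q where "q \<in> C" "p0 \<subseteq> q"
        using finite_subset_Union_chain[OF _ _ C] by blast
      then show "\<exists>c\<in>tuples U z. \<forall>\<psi>\<in>p0. sat (with_params U) c \<psi>"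
        using C(2) \<open>finite p0\<close> unfolding subset.chain_def S_def fs_def by blast
    qed
    then show "\<Union>C \<in> S" using C unfolding subset.chain_def S_def by blast
  qed
  then obtain q where q: "q \<in> S" "\<And>X. X \<in> S \<Longrightarrow> q \<subseteq> X \<Longrightarrow> X = q" by blast
  have "\<psi> \<in> q \<or> Neg \<psi> \<in> q" if \<psi>: "\<psi> \<in> fmls (param_lang L A) z" for \<psi>
  proof (rule ccontr)
    assume neg: "\<not> (\<psi> \<in> q \<or> Neg \<psi> \<in> q)"
    have N: "Neg \<psi> \<in> fmls (param_lang L A) z" using \<psi> by (simp add: fmls_def)
    have "\<not> fs (insert \<psi> q)" using q(2)[of "insert \<psi> q"] q(1) \<psi> neg unfolding S_def by blast
    then obtain p1 where p1: "finite p1" "p1 \<subseteq> insert \<psi> q"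
      "\<not> (\<exists>c\<in>tuples U z. \<forall>\<psi>\<in>p1. sat (with_params U) c \<psi>)" unfolding fs_def by blast
    have "\<not> fs (insert (Neg \<psi>) q)" using q(2)[of "insert (Neg \<psi>) q"] q(1) N neg unfolding S_def by blast
    then obtain p2 where p2: "finite p2" "p2 \<subseteq> insert (Neg \<psi>) q"
      "\<not> (\<exists>c\<in>tuples U z. \<forall>\<psi>\<in>p2. sat (with_params U) c \<psi>)" unfolding fs_def by blast
    have sub: "finite ((p1 - {\<psi>}) \<union> (p2 - {Neg \<psi>}))" "(p1 - {\<psi>}) \<union> (p2 - {Neg \<psi>}) \<subseteq> q"
      using p1 p2 by auto
    have "fs q" using q(1) by (simp add: S_def)
    from this[unfolded fs_def, rule_format, OF sub] obtain c where c: "c \<in> tuples U z"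
      "\<forall>\<psi>\<in>(p1 - {\<psi>}) \<union> (p2 - {Neg \<psi>}). sat (with_params U) c \<psi>"
      by blast
    show False
    proof (cases "sat (with_params U) c \<psi>")
      case True
      then have "\<forall>\<theta>\<in>p1. sat (with_params U) c \<theta>"
        using c(2) by (metis DiffI UnCI singletonD)
      then show False using p1(3) c(1) by blast
    next
      case False
      then have "sat (with_params U) c (Neg \<psi>)" by simp
      then have "\<forall>\<theta>\<in>p2. sat (with_params U) c \<theta>"
        using c(2) by (metis DiffI UnCI singletonD)
      then show False using p2(3) c(1) by blast
    qed
  qed
  moreover have "fs q" "q \<subseteq> fmls (param_lang L A) z" "p \<subseteq> q" using q(1) by (simp_all add: S_def)
  ultimately show ?thesis
    by (intro bexI[of _ q]) (simp_all add: type_space_def fs_def)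
qed

lemma saturation_one_variable:
  assumes sat: "saturated L \<kappa> U"
    and A: "A \<subseteq> univ U" "small \<kappa> A"
    and def: "\<And>j. j \<in> J \<Longrightarrow> definable L U A {n} (Q j)"
    and loc: "\<And>j e e'. j \<in> J \<Longrightarrow> e n = e' n \<Longrightarrow> Q j e = Q j e'"
    and fin: "\<And>J0. finite J0 \<Longrightarrow> J0 \<subseteq> J \<Longrightarrow> \<exists>c\<in>univ U. \<forall>j\<in>J0. Q j (e(n := c))"
  shows "\<exists>c\<in>univ U. \<forall>j\<in>J. Q j (e(n := c))"
proof -
  obtain \<psi> where \<psi>: "\<And>j. j \<in> J \<Longrightarrow> \<psi> j \<in> fmls (param_lang L A) {n}"
    "\<And>j e. j \<in> J \<Longrightarrow> e ` {n} \<subseteq> univ U \<Longrightarrow> Q j e \<longleftrightarrow> sat (with_params U) e (\<psi> j)"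
    using def unfolding definable_def by metis
  have "\<exists>c\<in>tuples U {n}. \<forall>\<theta>\<in>p0. sat (with_params U) c \<theta>" if p0: "finite p0" "p0 \<subseteq> \<psi> ` J" for p0
  proof -
    obtain J0 where J0: "J0 \<subseteq> J" "finite J0" "p0 = \<psi> ` J0"
      using finite_subset_image[OF p0] by blast
    obtain c where c: "c \<in> univ U" "\<forall>j\<in>J0. Q j (e(n := c))" using fin J0 by blast
    define t where "t = (\<lambda>v\<in>{n}. c)"
    have "t \<in> tuples U {n}" using c(1) by (auto simp: t_def tuples_def)
    moreover have "sat (with_params U) t (\<psi> j)" if "j \<in> J0" for j
    proof -
      have "Q j t = Q j (e(n := c))" using that J0(1) by (intro loc) (auto simp: t_def)
      then show ?thesis using \<psi>(2)[of j t] c that J0(1) by (auto simp: t_def)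
    qed
    ultimately show ?thesis using J0(3) by blast
  qed
  then obtain q where "q \<in> type_space L U A {n}" "\<psi> ` J \<subseteq> q"
    using complete_type_extension[of "\<psi> ` J" L A "{n}" U] \<psi>(1) by blast
  then obtain t where t: "t \<in> tuples U {n}" "\<forall>\<theta>\<in>\<psi> ` J. sat (with_params U) t \<theta>"
    using sat A unfolding saturated_def realizes_def by (meson finite.emptyI finite.insertI subsetD)
  have tn: "t n \<in> univ U" using t(1) by (auto simp: tuples_def)
  moreover have "Q j (e(n := t n))" if "j \<in> J" for j
  proof -
    have "Q j t" using \<psi>(2)[OF that, of t] tn t(2) that by auto
    then show ?thesis using loc[OF that, of t "e(n := t n)"] by simp
  qed
  ultimately show ?thesis by blast
qed

text \<open>Saturation realizes types in finitely many variables; here a type in all the variables is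
realized by choosing the values of the variables one after the other. The invariant is that
every finite part of the type still has a solution that extends the values chosen so far.
For a finite part this is a condition on the next value that is definable over \<open>A\<close> and the
previous values (quantify out the finitely many later variables), so a value that suits all
finite parts exists by saturation.\<close>

lemma countable_saturation:
  fixes \<psi> :: "'i \<Rightarrow> ('f + 'a, 'r) fm"
  assumes \<kappa>: "Card_order \<kappa>" "natLeq <o \<kappa>" and sat: "saturated L \<kappa> U" and ne: "univ U \<noteq> {}"
    and A: "A \<subseteq> univ U" "small \<kappa> A"
    and wf: "\<And>j. j \<in> J \<Longrightarrow> \<psi> j \<in> fmls (param_lang L A) UNIV"
    and fin: "\<And>J0. finite J0 \<Longrightarrow> J0 \<subseteq> J \<Longrightarrow>
       \<exists>e. range e \<subseteq> univ U \<and> (\<forall>j\<in>J0. sat (with_params U) e (\<psi> j))"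
  shows "\<exists>e. range e \<subseteq> univ U \<and> (\<forall>j\<in>J. sat (with_params U) e (\<psi> j))"
proof -
  define ext where "ext n J0 e \<longleftrightarrow> (\<exists>e'. range e' \<subseteq> univ U \<and> (\<forall>i<n. e' i = e i) \<and>
      (\<forall>j\<in>J0. sat (with_params U) e' (\<psi> j)))" for n :: nat and J0 and e :: "nat \<Rightarrow> 'a"
  define good where "good n e \<longleftrightarrow> range e \<subseteq> univ U \<and> (\<forall>J0. finite J0 \<longrightarrow> J0 \<subseteq> J \<longrightarrow> ext n J0 e)" for n e
  have step: "\<exists>e'. good (Suc n) e' \<and> (\<forall>i<n. e' i = e i)" if good: "good n e" for n e
  proof -
    define B where "B = A \<union> e ` {..<n}"
    have B: "B \<subseteq> univ U" "small \<kappa> B"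
      using A good small_Un_countable[OF \<kappa> A(2), of "e ` {..<n}"]
      by (auto simp: B_def good_def)
    define Q where "Q J0 f \<longleftrightarrow> ext (Suc n) J0 (e(n := f n))" for J0 and f :: "nat \<Rightarrow> 'a"
    have "\<exists>c\<in>univ U. \<forall>J0\<in>{J0. finite J0 \<and> J0 \<subseteq> J}. Q J0 (e(n := c))"
    proof (rule saturation_one_variable[OF sat B])
      show "definable L U B {n} (Q J0)" if "J0 \<in> {J0. finite J0 \<and> J0 \<subseteq> J}" for J0
      proof -
        have J0: "finite J0" "J0 \<subseteq> J" using that by auto
        \<comment> \<open>The later variables, to be quantified out; the earlier ones become parameters.\<close>
        define W where "W = (\<Union>j\<in>J0. fv (\<psi> j)) - {..n}"
        have W: "finite W" using J0 by (simp add: W_def finite_fv)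
        define \<sigma> where "\<sigma> v = (if v < n then Inl (e v) else Inr v)" for v
        define R where "R f \<longleftrightarrow> (\<forall>j\<in>J0. sat (with_params U) (\<lambda>v. case_sum id f (\<sigma> v)) (\<psi> j))" for f
        have "definable L U B (W \<union> {n}) R"
          unfolding R_def
        proof (rule definable_finite_ball[OF J0(1)])
          fix j assume j: "j \<in> J0"
          have "\<psi> j \<in> fmls (param_lang L A) (fv (\<psi> j))"
            using wf j J0 by (auto simp: fmls_def)
          then show "definable L U B (W \<union> {n})
              (\<lambda>f. sat (with_params U) (\<lambda>v. case_sum id f (\<sigma> v)) (\<psi> j))"
            by (rule definable_subst) (use j in \<open>auto simp: B_def \<sigma>_def W_def\<close>)
        qed
        moreover have "R f = R f'" if ff: "\<And>v. v \<in> W \<union> {n} \<Longrightarrow> f v = f' v" for f f'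
        proof -
          have "sat (with_params U) (\<lambda>v. case_sum id f (\<sigma> v)) (\<psi> j) =
              sat (with_params U) (\<lambda>v. case_sum id f' (\<sigma> v)) (\<psi> j)" if "j \<in> J0" for j
          proof (rule sat_cong)
            fix v assume "v \<in> fv (\<psi> j)"
            then have "v < n \<or> v \<in> W \<union> {n}" using that by (auto simp: W_def)
            then show "case_sum id f (\<sigma> v) = case_sum id f' (\<sigma> v)"
              using ff by (auto simp: \<sigma>_def)
          qed
          then show ?thesis by (simp add: R_def)
        qed
        ultimately have D: "definable L U B {n} (\<lambda>f. \<exists>c. c ` W \<subseteq> univ U \<and> R (override_on f c W))"
          by (rule definable_ex_finite[OF W])
        have "(\<exists>c. c ` W \<subseteq> univ U \<and> R (override_on f c W)) \<longleftrightarrow> Q J0 f"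
          if fn: "f ` {n} \<subseteq> univ U" for f
        proof
          assume "\<exists>c. c ` W \<subseteq> univ U \<and> R (override_on f c W)"
          then obtain c where c: "c ` W \<subseteq> univ U" "R (override_on f c W)" by blast
          define e' where "e' v = (if v < n then e v else if v \<in> W then c v else f n)" for v
          have "range e' \<subseteq> univ U" using c(1) fn good by (auto simp: e'_def good_def)
          moreover have "sat (with_params U) e' (\<psi> j)" if j: "j \<in> J0" for j
          proof -
            have "sat (with_params U) (\<lambda>v. case_sum id (override_on f c W) (\<sigma> v)) (\<psi> j)"
              using c(2) j by (simp add: R_def)
            moreover have "case_sum id (override_on f c W) (\<sigma> v) = e' v" if "v \<in> fv (\<psi> j)" for v
              using that j by (cases v n rule: linorder_cases) (auto simp: \<sigma>_def e'_def W_def)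
            ultimately show ?thesis by (metis (no_types, lifting) sat_cong)
          qed
          moreover have "\<forall>i<Suc n. e' i = (e(n := f n)) i"
            by (auto simp: e'_def less_Suc_eq W_def)
          ultimately show "Q J0 f" unfolding Q_def ext_def by blast
        next
          assume "Q J0 f"
          then obtain e' where e': "range e' \<subseteq> univ U" "\<forall>i<Suc n. e' i = (e(n := f n)) i"
            "\<forall>j\<in>J0. sat (with_params U) e' (\<psi> j)"
            unfolding Q_def ext_def by blast
          have "R (override_on f e' W)" unfolding R_def
          proof
            fix j assume j: "j \<in> J0"
            have "case_sum id (override_on f e' W) (\<sigma> v) = e' v" if "v \<in> fv (\<psi> j)" for v
              using that j e'(2)
              by (cases v n rule: linorder_cases) (auto simp: \<sigma>_def W_def override_on_def)
            then show "sat (with_params U) (\<lambda>v. case_sum id (override_on f e' W) (\<sigma> v)) (\<psi> j)"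
              using e'(3) j by (metis (no_types, lifting) sat_cong)
          qed
          then show "\<exists>c. c ` W \<subseteq> univ U \<and> R (override_on f c W)"
            using e'(1) by (intro exI[of _ e']) auto
        qed
        then show ?thesis using D unfolding definable_def by metis
      qed
      show "Q J0 f = Q J0 f'" if "f n = f' n" for J0 f f'
        using that by (simp add: Q_def)
      show "\<exists>c\<in>univ U. \<forall>J0\<in>F. Q J0 (e(n := c))"
        if F: "finite F" "F \<subseteq> {J0. finite J0 \<and> J0 \<subseteq> J}" for F
      proof -
        have "finite (\<Union>F)" "\<Union>F \<subseteq> J" using F by auto
        then have "ext n (\<Union>F) e" using good unfolding good_def by blast
        then obtain e' where e': "range e' \<subseteq> univ U" "\<forall>i<n. e' i = e i"
          "\<forall>j\<in>\<Union>F. sat (with_params U) e' (\<psi> j)"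
          unfolding ext_def by blast
        then have "Q J0 (e(n := e' n))" if "J0 \<in> F" for J0
          using that unfolding Q_def ext_def by (intro exI[of _ e']) (auto simp: less_Suc_eq)
        then show ?thesis using e'(1) by blast
      qed
    qed
    then obtain c where c: "c \<in> univ U" "\<And>J0. finite J0 \<Longrightarrow> J0 \<subseteq> J \<Longrightarrow> Q J0 (e(n := c))"
      by blast
    then have "good (Suc n) (e(n := c))" using good by (auto simp: good_def Q_def)
    then show ?thesis by (intro exI[of _ "e(n := c)"]) auto
  qed
  obtain u where "u \<in> univ U" using ne by blast
  then have "good 0 (\<lambda>_. u)" using fin by (auto simp: good_def ext_def)
  with step obtain s where s: "\<And>n. good n (s n)" "\<And>n i. i < n \<Longrightarrow> s (Suc n) i = s n i"
    using dependent_nat_choice[of good "\<lambda>n e e'. \<forall>i<n. e' i = e i"] by metis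
  define e where "e i = s (Suc i) i" for i
  have s_eq: "s n i = e i" if "i < n" for n i
    using that
  proof (induction n)
    case (Suc n)
    then show ?case using s(2)[of i n] by (cases "i = n") (auto simp: e_def)
  qed simp
  have "range e \<subseteq> univ U" using s(1) by (auto simp: good_def e_def)
  moreover have "sat (with_params U) e (\<psi> j)" if j: "j \<in> J" for j
  proof -
    obtain n where n: "fv (\<psi> j) \<subseteq> {..<n}"
      using finite_fv[of "\<psi> j"] finite_nat_bounded by blast
    have "ext n {j} (s n)" using s(1)[of n] j unfolding good_def by blast
    then obtain e' where e': "\<forall>i<n. e' i = s n i" "sat (with_params U) e' (\<psi> j)"
      unfolding ext_def by blast
    have "e' v = e v" if "v \<in> fv (\<psi> j)" for v using that n e'(1) s_eq by auto
    then show ?thesis using e'(2) sat_cong by metis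
  qed
  ultimately show ?thesis by blast
qed

lemma saturation_for_predicates:
  assumes \<kappa>: "Card_order \<kappa>" "natLeq <o \<kappa>" and sat: "saturated L \<kappa> U" and ne: "univ U \<noteq> {}"
    and A: "A \<subseteq> univ U" "small \<kappa> A"
    and def: "\<And>j. j \<in> J \<Longrightarrow> definable L U A UNIV (Q j)"
    and fin: "\<And>J0. finite J0 \<Longrightarrow> J0 \<subseteq> J \<Longrightarrow> \<exists>e. range e \<subseteq> univ U \<and> (\<forall>j\<in>J0. Q j e)"
  shows "\<exists>e. range e \<subseteq> univ U \<and> (\<forall>j\<in>J. Q j e)"
proof -
  obtain \<psi> where \<psi>: "\<And>j. j \<in> J \<Longrightarrow> \<psi> j \<in> fmls (param_lang L A) UNIV"
    "\<And>j e. j \<in> J \<Longrightarrow> range e \<subseteq> univ U \<Longrightarrow> Q j e \<longleftrightarrow> sat (with_params U) e (\<psi> j)"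
    using def unfolding definable_def by metis
  have "\<exists>e. range e \<subseteq> univ U \<and> (\<forall>j\<in>J. sat (with_params U) e (\<psi> j))"
    using \<kappa> sat ne A \<psi>(1)
  proof (rule countable_saturation)
    fix J0 assume "finite J0" "J0 \<subseteq> J"
    then show "\<exists>e. range e \<subseteq> univ U \<and> (\<forall>j\<in>J0. sat (with_params U) e (\<psi> j))"
      using fin[of J0] \<psi>(2) by (meson subsetD)
  qed
  then show ?thesis using \<psi>(2) by blast
qed

section \<open>Bounded dual shattering from NIP\<close>

text \<open>Bridges an arbitrary assignment, such as one that renames blocks of variables, and the
definition of an instance.\<close>

lemma sat_inst_iff:
  assumes \<phi>: "fv \<phi> \<subseteq> x \<union> y" and xy: "x \<inter> y = {}" and a: "a \<in> tuples U x"
    and ea: "\<And>v. v \<in> x \<Longrightarrow> e v = a v" and eb: "\<And>v. v \<in> y \<Longrightarrow> e v = b v"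
  shows "sat (with_params U) e \<phi> \<longleftrightarrow> a \<in> inst U x \<phi> b"
proof -
  have "sat (with_params U) e \<phi> \<longleftrightarrow> sat (with_params U) (override_on b a x) \<phi>"
    using \<phi> xy ea eb by (intro sat_cong) (auto simp: override_on_def)
  with a show ?thesis by (simp add: inst_def)
qed

lemma definable_iff_const:
  assumes "definable L U A z Q" shows "definable L U A z (\<lambda>e. Q e \<longleftrightarrow> P)"
  using assms definable_not[OF assms] by (cases P) simp_all

text \<open>The usual passage to the dual: if points shatter \<open>2 ^ n\<close> instances, index \<open>2 ^ n\<close> of these
instances by the subsets \<open>I\<close> of \<open>{..<n}\<close> and let \<open>a i\<close> be a point that satisfies exactly
those with \<open>i \<in> I\<close>.\<close>

lemma independent_of_dual_shattered:
  fixes S :: "'b set" and E :: "'a \<Rightarrow> 'b \<Rightarrow> bool"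
  assumes S: "finite S" "2 ^ n \<le> card S" and sh: "shatters ((\<lambda>a. {b\<in>S. E a b}) ` X) S"
  shows "\<exists>a b. (\<forall>i<n. a i \<in> X) \<and> (\<forall>I\<subseteq>{..<n}. b I \<in> S) \<and>
           (\<forall>i<n. \<forall>I\<subseteq>{..<n}. E (a i) (b I) \<longleftrightarrow> i \<in> I)"
proof -
  have "card (Pow {..<n}) \<le> card S" using S(2) by (simp add: card_Pow)
  then obtain b where b: "inj_on b (Pow {..<n})" "b ` Pow {..<n} \<subseteq> S"
    using card_le_inj[of "Pow {..<n}" S] S(1) by auto
  have "\<exists>a\<in>X. {c\<in>S. E a c} = b ` {I. I \<subseteq> {..<n} \<and> i \<in> I}" for i
  proof -
    have "b ` {I. I \<subseteq> {..<n} \<and> i \<in> I} \<subseteq> S" using b(2) by auto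
    with sh have "\<exists>a\<in>X. {c\<in>S. E a c} \<inter> S = b ` {I. I \<subseteq> {..<n} \<and> i \<in> I}"
      unfolding shatters_def by (metis (no_types, lifting) imageE)
    moreover have "{c\<in>S. E a c} \<inter> S = {c\<in>S. E a c}" for a by blast
    ultimately show ?thesis by simp
  qed
  then obtain a where a: "\<And>i. a i \<in> X" "\<And>i. {c\<in>S. E (a i) c} = b ` {I. I \<subseteq> {..<n} \<and> i \<in> I}"
    by metis
  have "E (a i) (b I) \<longleftrightarrow> i \<in> I" if I: "I \<subseteq> {..<n}" for i I
  proof -
    have "E (a i) (b I) \<longleftrightarrow> b I \<in> {c\<in>S. E (a i) c}" using b(2) I by auto
    also have "\<dots> \<longleftrightarrow> b I \<in> b ` {I. I \<subseteq> {..<n} \<and> i \<in> I}" by (simp only: a(2))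
    also have "\<dots> \<longleftrightarrow> I \<in> {I. I \<subseteq> {..<n} \<and> i \<in> I}"
      using I by (intro inj_on_image_mem_iff[OF b(1)]) auto
    finally show ?thesis using I by simp
  qed
  with a(1) b(2) show ?thesis by (intro exI[of _ a] exI[of _ b]) auto
qed

text \<open>NIP forbids one infinite independent pattern, indexed by all subsets of \<open>\<nat>\<close>; uniform finite
bounds need saturation twice. If the bounds failed, there would be independent patterns of
every finite size. Countably many variables suffice for points \<open>a\<^sub>i\<close> and instances \<open>b\<^sub>I\<close>
with \<open>I\<close> ranging over the finite subsets of \<open>\<nat>\<close>, so one infinite pattern of this kind is
realized. With the points \<open>a\<^sub>i\<close> now as parameters, the instance for an arbitrary \<open>I\<close> is
finitely approximated by the instances already found.\<close>

lemma NIP_bounds_dual_shattering: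
  fixes U :: "('f, 'r, 'a) fo_struct"
  assumes \<kappa>: "Card_order \<kappa>" "natLeq <o \<kappa>" and sat: "saturated L \<kappa> U" and ne: "univ U \<noteq> {}"
    and A: "A \<subseteq> univ U" "small \<kappa> A"
    and xy: "x \<inter> y = {}" and \<phi>: "\<phi> \<in> fmls (param_lang L A) (x \<union> y)"
    and nip: "NIP U x y \<phi>"
  shows "\<exists>d. \<forall>S. finite S \<longrightarrow> S \<subseteq> tuples U y \<longrightarrow>
     shatters ((\<lambda>a. {b\<in>S. a \<in> inst U x \<phi> b}) ` tuples U x) S \<longrightarrow> card S \<le> d"
proof (rule ccontr)
  assume "\<not> ?thesis"
  then have unb: "\<exists>S. finite S \<and> S \<subseteq> tuples U y \<and>
     shatters ((\<lambda>a. {b\<in>S. a \<in> inst U x \<phi> b}) ` tuples U x) S \<and> d < card S" for d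
    by (meson not_le)
  have fvx: "fv \<phi> \<subseteq> x \<union> y" using \<phi> by (simp add: fmls_def)
  have ind: "\<exists>a b. (\<forall>i<n. a i \<in> tuples U x) \<and> (\<forall>I\<subseteq>{..<n}. b I \<in> tuples U y) \<and>
           (\<forall>i<n. \<forall>I\<subseteq>{..<n}. a i \<in> inst U x \<phi> (b I) \<longleftrightarrow> i \<in> I)" for n :: nat
  proof -
    obtain S where S: "finite S" "S \<subseteq> tuples U y" "2 ^ n \<le> card S"
      "shatters ((\<lambda>a. {b\<in>S. a \<in> inst U x \<phi> b}) ` tuples U x) S"
      using unb[of "2 ^ n"] less_imp_le by blast
    from independent_of_dual_shattered[OF S(1,3,4)] obtain a b where
      "\<forall>i<n. a i \<in> tuples U x" "\<forall>I\<subseteq>{..<n}. b I \<in> S"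
      "\<forall>i<n. \<forall>I\<subseteq>{..<n}. a i \<in> inst U x \<phi> (b I) \<longleftrightarrow> i \<in> I"
      by (elim exE conjE) (rule that)
    with S(2) show ?thesis by (intro exI[of _ a] exI[of _ b]) auto
  qed
  \<comment> \<open>Even blocks of variables hold the points, odd blocks the instances, which are indexed by the
    codes of finite sets.\<close>
  define var where "var i k v = (if v \<in> x then prod_encode (2 * i, v) else prod_encode (Suc (2 * k), v))"
    for i k v :: nat
  have "\<exists>e. range e \<subseteq> univ U \<and>
     (\<forall>j\<in>UNIV. sat (with_params U) (\<lambda>v. e (var (fst j) (snd j) v)) \<phi> \<longleftrightarrow> fst j \<in> set_decode (snd j))"
  proof (rule saturation_for_predicates[OF \<kappa> sat ne A])
    fix j :: "nat \<times> nat"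
    have "definable L U A UNIV
        (\<lambda>e. sat (with_params U) (\<lambda>v. case_sum id e (Inr (var (fst j) (snd j) v) :: 'a + nat)) \<phi>)"
      using \<phi> by (rule definable_subst) auto
    then show "definable L U A UNIV (\<lambda>e. sat (with_params U) (\<lambda>v. e (var (fst j) (snd j) v)) \<phi>
        \<longleftrightarrow> fst j \<in> set_decode (snd j))"
      by (intro definable_iff_const) simp
  next
    fix J0 :: "(nat \<times> nat) set" assume J0: "finite J0"
    obtain n where n: "fst ` J0 \<subseteq> {..<n}" using J0 finite_nat_bounded by blast
    from ind[of n] obtain a b where ab':
      "\<forall>i<n. a i \<in> tuples U x" "\<forall>I\<subseteq>{..<n}. b I \<in> tuples U y"
      "\<forall>i<n. \<forall>I\<subseteq>{..<n}. a i \<in> inst U x \<phi> (b I) \<longleftrightarrow> i \<in> I"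
      by (elim exE conjE) (rule that)
    note ab = ab'(1)[rule_format] ab'(2)[rule_format] ab'(3)[rule_format]
    obtain u where u: "u \<in> univ U" using ne by blast
    define e where "e w = (let c = fst (prod_decode w); v = snd (prod_decode w) in
        if even c \<and> c div 2 < n \<and> v \<in> x then a (c div 2) v
        else if odd c \<and> v \<in> y then b (set_decode (c div 2) \<inter> {..<n}) v else u)" for w
    have "e w \<in> univ U" for w
      using u ab(1)[of "fst (prod_decode w) div 2"]
        ab(2)[of "set_decode (fst (prod_decode w) div 2) \<inter> {..<n}"]
      by (auto simp: e_def Let_def tuples_def)
    moreover have "sat (with_params U) (\<lambda>v. e (var i k v)) \<phi> \<longleftrightarrow> i \<in> set_decode k"
      if "(i, k) \<in> J0" for i k
    proof -
      have i: "i < n" using that n by force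
      have "sat (with_params U) (\<lambda>v. e (var i k v)) \<phi> \<longleftrightarrow>
          a i \<in> inst U x \<phi> (b (set_decode k \<inter> {..<n}))"
        using fvx xy ab(1)[OF i] by (rule sat_inst_iff) (use i xy in \<open>auto simp: e_def var_def\<close>)
      then show ?thesis using ab(3)[OF i] i by simp
    qed
    ultimately show "\<exists>e. range e \<subseteq> univ U \<and> (\<forall>j\<in>J0.
        sat (with_params U) (\<lambda>v. e (var (fst j) (snd j) v)) \<phi> \<longleftrightarrow> fst j \<in> set_decode (snd j))"
      by (intro exI[of _ e]) auto
  qed
  then obtain e where e: "range e \<subseteq> univ U"
    "\<And>i k. sat (with_params U) (\<lambda>v. e (var i k v)) \<phi> \<longleftrightarrow> i \<in> set_decode k"
    by auto
  define a where "a i = (\<lambda>v\<in>x. e (prod_encode (2 * i, v)))" for i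
  have a: "a i \<in> tuples U x" for i using e(1) by (auto simp: a_def tuples_def)
  have "\<exists>b\<in>tuples U y. \<forall>i. a i \<in> inst U x \<phi> b \<longleftrightarrow> i \<in> I" for I
  proof -
    define B where "B = A \<union> range e"
    have B: "B \<subseteq> univ U" "small \<kappa> B"
      using A e(1) small_Un_countable[OF \<kappa> A(2), of "range e"] by (auto simp: B_def)
    define Q where "Q i f \<longleftrightarrow>
        (sat (with_params U) (\<lambda>v. if v \<in> x then e (prod_encode (2 * i, v)) else f v) \<phi> \<longleftrightarrow> i \<in> I)"
      for i f
    have "\<exists>f. range f \<subseteq> univ U \<and> (\<forall>i\<in>UNIV. Q i f)"
    proof (rule saturation_for_predicates[OF \<kappa> sat ne B])
      fix i :: nat
      define \<sigma> where "\<sigma> v = (if v \<in> x then Inl (e (prod_encode (2 * i, v))) else Inr v)" for v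
      have "definable L U B UNIV (\<lambda>f. sat (with_params U) (\<lambda>v. case_sum id f (\<sigma> v)) \<phi>)"
        using \<phi> by (rule definable_subst) (auto simp: B_def \<sigma>_def)
      moreover have "case_sum id f (\<sigma> v) = (if v \<in> x then e (prod_encode (2 * i, v)) else f v)" for f v
        by (simp add: \<sigma>_def)
      ultimately show "definable L U B UNIV (Q i)"
        unfolding Q_def by (intro definable_iff_const) simp
    next
      fix J0 :: "nat set" assume J0: "finite J0"
      define k where "k = set_encode (I \<inter> J0)"
      have "Q i (\<lambda>v. e (prod_encode (Suc (2 * k), v)))" if "i \<in> J0" for i
        using e(2)[of i k] that J0 by (simp add: Q_def var_def k_def if_distrib[of e])
      then show "\<exists>f. range f \<subseteq> univ U \<and> (\<forall>i\<in>J0. Q i f)"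
        using e(1) by (intro exI[of _ "\<lambda>v. e (prod_encode (Suc (2 * k), v))"]) auto
    qed
    then obtain f where f: "range f \<subseteq> univ U" "\<And>i. Q i f" by blast
    define b where "b = restrict f y"
    have "b \<in> tuples U y" using f(1) by (auto simp: b_def tuples_def)
    moreover have "a i \<in> inst U x \<phi> b \<longleftrightarrow> i \<in> I" for i
    proof -
      have "sat (with_params U) (\<lambda>v. if v \<in> x then e (prod_encode (2 * i, v)) else f v) \<phi> \<longleftrightarrow>
          a i \<in> inst U x \<phi> b"
        using fvx xy a by (rule sat_inst_iff) (use xy in \<open>auto simp: a_def b_def\<close>)
      then show ?thesis using f(2)[of i] by (simp add: Q_def)
    qed
    ultimately show ?thesis by blast
  qed
  then obtain b where b: "\<And>I. b I \<in> tuples U y" "\<And>i I. a i \<in> inst U x \<phi> (b I) \<longleftrightarrow> i \<in> I"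
    by metis
  have "\<exists>(a :: nat \<Rightarrow> nat \<Rightarrow> _) (b :: nat set \<Rightarrow> nat \<Rightarrow> _).
     range a \<subseteq> tuples U x \<and> range b \<subseteq> tuples U y \<and> (\<forall>i I. a i \<in> inst U x \<phi> (b I) \<longleftrightarrow> i \<in> I)"
    using a b by (intro exI[of _ a] exI[of _ b]) auto
  with nip show False unfolding NIP_def by blast
qed

section \<open>Definable measures and types\<close>

lemma tp_in_type_space:
  assumes "b \<in> tuples U z" shows "tp L U A z b \<in> type_space L U A z"
  using assms by (auto simp: tp_def type_space_def fmls_def)

lemma realizes_tp_iff:
  "realizes U z b' (tp L U A z b) \<longleftrightarrow> b' \<in> tuples U z \<and> tp L U A z b' = tp L U A z b"
proof
  assume r: "realizes U z b' (tp L U A z b)"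
  have "sat (with_params U) b' \<psi> \<longleftrightarrow> sat (with_params U) b \<psi>"
    if "\<psi> \<in> fmls (param_lang L A) z" for \<psi>
  proof -
    have "Neg \<psi> \<in> fmls (param_lang L A) z" using that by (simp add: fmls_def)
    then show ?thesis using r that unfolding realizes_def tp_def by fastforce
  qed
  with r show "b' \<in> tuples U z \<and> tp L U A z b' = tp L U A z b"
    by (auto simp: tp_def realizes_def)
qed (auto simp: realizes_def tp_def)

text \<open>The generating sets of the type topology are closed under finite intersections, as formulas
are closed under conjunction, so a single formula describes a neighbourhood.\<close>

lemma open_nbhd_of_tp:
  assumes "openin (type_topology L U A z) Op" "tp L U A z b \<in> Op"
  shows "\<exists>\<psi>\<in>fmls (param_lang L A) z. sat (with_params U) b \<psi> \<and>
     (\<forall>b'\<in>tuples U z. sat (with_params U) b' \<psi> \<longrightarrow> tp L U A z b' \<in> Op)"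
proof -
  have "generate_topology_on {{p \<in> type_space L U A z. \<psi> \<in> p} | \<psi>. \<psi> \<in> fmls (param_lang L A) z} Op"
    using assms(1) by (simp add: type_topology_def openin_topology_generated_by_iff)
  then show ?thesis using assms(2)
  proof induction
    case (Int V W)
    then obtain \<psi> \<theta> where "\<psi> \<in> fmls (param_lang L A) z" "sat (with_params U) b \<psi>"
      "\<forall>b'\<in>tuples U z. sat (with_params U) b' \<psi> \<longrightarrow> tp L U A z b' \<in> V"
      "\<theta> \<in> fmls (param_lang L A) z" "sat (with_params U) b \<theta>"
      "\<forall>b'\<in>tuples U z. sat (with_params U) b' \<theta> \<longrightarrow> tp L U A z b' \<in> W"
      by blast
    then show ?case by (intro bexI[of _ "Conj \<psi> \<theta>"]) (auto simp: fmls_def)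
  next
    case (UN K)
    then obtain V where "V \<in> K" "tp L U A z b \<in> V" by blast
    with UN.IH[of V] show ?case by blast
  next
    case (Basis V)
    then obtain \<psi> where \<psi>: "\<psi> \<in> fmls (param_lang L A) z" "V = {p \<in> type_space L U A z. \<psi> \<in> p}"
      by blast
    then show ?case
      using Basis(2) by (intro bexI[of _ \<psi>]) (auto simp: tp_def intro: tp_in_type_space[unfolded tp_def])
  qed simp
qed

lemma fibre_map_tp:
  assumes "invariant_measure L U M x y \<phi> \<mu>" "b \<in> tuples U y"
  shows "fibre_map U x y \<phi> \<mu> (tp L U (univ M) y b) = \<mu> (inst U x \<phi> b)"
proof -
  define b' where "b' = (SOME b'. realizes U y b' (tp L U (univ M) y b))"
  have "realizes U y b' (tp L U (univ M) y b)"
    unfolding b'_def by (rule someI[of _ b]) (simp add: realizes_tp_iff assms(2))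
  then have "b' \<in> tuples U y" "tp L U (univ M) y b' = tp L U (univ M) y b"
    by (simp_all add: realizes_tp_iff)
  then show ?thesis
    using assms unfolding invariant_measure_def fibre_map_def b'_def[symmetric] by blast
qed

text \<open>By continuity the types of the instances with measure in \<open>C\<close> form a closed set, and a closed
set of types is cut out by formulas: if the measure at \<open>b\<close> were outside \<open>C\<close>, some formula
true of \<open>b\<close> would exclude \<open>C\<close> on a whole neighbourhood, and its negation would contradict
the assumption \<open>imp\<close>.\<close>

lemma measure_preimage_type_definable:
  assumes def: "definable_measure L U M x y \<phi> \<mu>" and C: "closed C" and b: "b \<in> tuples U y"
    and imp: "\<And>\<psi>. \<psi> \<in> fmls (param_lang L (univ M)) y \<Longrightarrow>
       (\<forall>b'\<in>tuples U y. \<mu> (inst U x \<phi> b') \<in> C \<longrightarrow> sat (with_params U) b' \<psi>) \<Longrightarrow>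
       sat (with_params U) b \<psi>"
  shows "\<mu> (inst U x \<phi> b) \<in> C"
proof (rule ccontr)
  let ?T = "type_topology L U (univ M) y" and ?F = "fibre_map U x y \<phi> \<mu>"
  let ?tp = "tp L U (univ M) y"
  assume nC: "\<mu> (inst U x \<phi> b) \<notin> C"
  have inv: "invariant_measure L U M x y \<phi> \<mu>" and cont: "continuous_map ?T (top_of_set {0..1}) ?F"
    using def by (auto simp: definable_measure_def)
  have F: "?F (?tp b') = \<mu> (inst U x \<phi> b')" if "b' \<in> tuples U y" for b'
    using fibre_map_tp[OF inv that] .
  have top: "?tp b' \<in> topspace ?T" if b': "b' \<in> tuples U y" for b'
  proof -
    let ?true = "Neg (Exists 0 (Neg (Eq (Var 0) (Var 0))))"
    have "?true \<in> fmls (param_lang L (univ M)) y" "?true \<in> ?tp b'"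
      by (auto simp: fmls_def tp_def)
    then show ?thesis
      using tp_in_type_space[OF b'] unfolding type_topology_def topology_generated_by_topspace by blast
  qed
  define Op where "Op = {q \<in> topspace ?T. ?F q \<in> {0..1} \<inter> - C}"
  have "openin (top_of_set {0..1}) ({0..1} \<inter> - C)"
    using C by (intro openin_open_Int) auto
  with cont have "openin ?T Op" unfolding Op_def by (rule openin_continuous_map_preimage)
  moreover have Op: "?tp b' \<in> Op \<longleftrightarrow> \<mu> (inst U x \<phi> b') \<notin> C" if b': "b' \<in> tuples U y" for b'
  proof -
    have "?F (?tp b') \<in> {0..1}" using continuous_map_image_subset_topspace[OF cont] top[OF b'] by auto
    then show ?thesis using F[OF b'] top[OF b'] by (simp add: Op_def)
  qed
  moreover have "?tp b \<in> Op" using Op b nC by blast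
  ultimately obtain \<psi> where \<psi>: "\<psi> \<in> fmls (param_lang L (univ M)) y" "sat (with_params U) b \<psi>"
    "\<forall>b'\<in>tuples U y. sat (with_params U) b' \<psi> \<longrightarrow> ?tp b' \<in> Op"
    using open_nbhd_of_tp[of L U "univ M" y Op b] by blast
  have "sat (with_params U) b (Neg \<psi>)"
  proof (rule imp)
    show "Neg \<psi> \<in> fmls (param_lang L (univ M)) y" using \<psi>(1) by (simp add: fmls_def)
    show "\<forall>b'\<in>tuples U y. \<mu> (inst U x \<phi> b') \<in> C \<longrightarrow> sat (with_params U) b' (Neg \<psi>)"
      using \<psi>(3) Op by auto
  qed
  then show False using \<psi>(2) by simp
qed

section \<open>One list of instances for all points of the model\<close>

text \<open>A colour that fails on some finite set fails on every larger one, so one finite set would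
defeat all colours at once.\<close>

lemma finite_pigeonhole_directed:
  assumes K: "finite K" and ex: "\<And>A. finite A \<Longrightarrow> A \<subseteq> X \<Longrightarrow> \<exists>q. P A q \<and> col q \<in> K"
    and mono: "\<And>A A' q. A \<subseteq> A' \<Longrightarrow> P A' q \<Longrightarrow> P A q"
  shows "\<exists>k\<in>K. \<forall>A. finite A \<longrightarrow> A \<subseteq> X \<longrightarrow> (\<exists>q. P A q \<and> col q = k)"
proof (rule ccontr)
  assume "\<not> ?thesis"
  then have "\<forall>k\<in>K. \<exists>A. finite A \<and> A \<subseteq> X \<and> (\<forall>q. P A q \<longrightarrow> col q \<noteq> k)" by simp
  then obtain A where A: "\<And>k. k \<in> K \<Longrightarrow> finite (A k)" "\<And>k. k \<in> K \<Longrightarrow> A k \<subseteq> X"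
    "\<And>k q. k \<in> K \<Longrightarrow> P (A k) q \<Longrightarrow> col q \<noteq> k" by metis
  have "finite (\<Union>k\<in>K. A k)" "(\<Union>k\<in>K. A k) \<subseteq> X" using K A(1,2) by auto
  then obtain q where q: "P (\<Union>k\<in>K. A k) q" "col q \<in> K" using ex by blast
  have "P (A (col q)) q" by (rule mono[OF _ q(1)]) (use q(2) in auto)
  then show False using A(3)[OF q(2)] by blast
qed

lemma mean_deviation_eq:
  "mean (deviation F E a) qs =
     (\<Sum>i<length qs. snd (qs ! i) * (F (fst (qs ! i)) - of_bool (E a (fst (qs ! i))))) / length qs"
  by (simp add: mean_def deviation_def sum_list_sum_nth atLeast0LessThan)

text \<open>The saturation step. For each finite \<open>A\<close> a list of \<open>N\<close> signed instances is given; a single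
list for all of \<open>M\<^sup>x\<close> is found by realizing a type over \<open>M\<close> in \<open>N\<close> blocks of variables.
Whether the mean deviation at \<open>a\<close> is large depends on the values of \<open>F\<close> at the instances, on
the signs and on the set \<open>B\<close> of the instances that hold at \<open>a\<close>. By the pigeonhole principle
the signs and the cells of a grid of width \<open>\<delta>\<close> that contain the values of \<open>F\<close> may be taken
to be the same for all \<open>A\<close>. Then the type says that the instances lie in these cells, which
is type-definable, and that no point of \<open>M\<close> has a pattern \<open>B\<close> for which the mean deviation
would be too small. Each use of a grid point in place of the value of \<open>F\<close> costs \<open>\<delta> = c/4\<close>,
so at least \<open>c/2\<close> remains.\<close>

lemma uniform_deviation_sample:
  fixes U M :: "('f, 'r, 'a) fo_struct" and x y :: "nat set" and \<phi> :: "('f + 'a, 'r) fm"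
    and \<mu> :: "(nat \<Rightarrow> 'a) set \<Rightarrow> real"
  defines "F \<equiv> \<lambda>b. \<mu> (inst U x \<phi> b)" and "E \<equiv> \<lambda>a b. a \<in> inst U x \<phi> b"
  assumes \<kappa>: "Card_order \<kappa>" "natLeq <o \<kappa>" and sat: "saturated L \<kappa> U" and ne: "univ U \<noteq> {}"
    and M: "univ M \<subseteq> univ U" "small \<kappa> (univ M)" "univ M \<noteq> {}"
    and xy: "x \<inter> y = {}" and \<phi>: "\<phi> \<in> fmls (param_lang L (univ M)) (x \<union> y)"
    and def: "definable_measure L U M x y \<phi> \<mu>"
    and F: "F ` tuples U y \<subseteq> {0..1}" and c: "0 < c" and N: "0 < N"
    and fin: "\<And>A. finite A \<Longrightarrow> A \<noteq> {} \<Longrightarrow> A \<subseteq> tuples M x \<Longrightarrow>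
       \<exists>qs. set qs \<subseteq> tuples U y \<times> {1, -1} \<and> length qs = N \<and>
         (\<forall>a\<in>A. mean (deviation F E a) qs \<ge> c)"
  shows "\<exists>qs. set qs \<subseteq> tuples U y \<times> {1, -1} \<and> length qs = N \<and>
         (\<forall>a\<in>tuples M x. mean (deviation F E a) qs > 0)"
proof -
  define \<delta> where "\<delta> = c / 4"
  have \<delta>: "0 < \<delta>" using c by (simp add: \<delta>_def)
  define cell where "cell = (\<lambda>(b, s :: real). (s, \<lfloor>F b / \<delta>\<rfloor>))"
  define P where "P A qs \<longleftrightarrow> set qs \<subseteq> tuples U y \<times> {1, -1} \<and> length qs = N \<and>
         (\<forall>a\<in>A. mean (deviation F E a) qs \<ge> c)" for A qs
  define C where "C = {cs. set cs \<subseteq> {1, -1 :: real} \<times> {0..\<lfloor>1 / \<delta>\<rfloor>} \<and> length cs = N}"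
  obtain w where w: "w \<in> univ M" using M(3) by blast
  define a0 where "a0 = (\<lambda>v\<in>x. w)"
  have a0: "a0 \<in> tuples M x" using w by (auto simp: a0_def tuples_def)
  have cell: "map cell qs \<in> C" if "set qs \<subseteq> tuples U y \<times> {1, -1}" "length qs = N" for qs
  proof -
    have "cell p \<in> {1, -1} \<times> {0..\<lfloor>1 / \<delta>\<rfloor>}" if p: "p \<in> tuples U y \<times> {1, -1}" for p
    proof -
      have "0 \<le> F (fst p)" "F (fst p) \<le> 1" using p F by force+
      then have "0 \<le> \<lfloor>F (fst p) / \<delta>\<rfloor>" "\<lfloor>F (fst p) / \<delta>\<rfloor> \<le> \<lfloor>1 / \<delta>\<rfloor>"
        using \<delta> by (auto intro!: floor_mono divide_right_mono)
      then show ?thesis using p by (auto simp: cell_def split: prod.splits)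
    qed
    then have "cell ` set qs \<subseteq> {1, -1} \<times> {0..\<lfloor>1 / \<delta>\<rfloor>}" using that(1) by blast
    with that(2) show ?thesis by (simp add: C_def)
  qed
  have "\<exists>cs\<in>C. \<forall>A. finite A \<longrightarrow> A \<subseteq> tuples M x \<longrightarrow> (\<exists>qs. P A qs \<and> map cell qs = cs)"
  proof (rule finite_pigeonhole_directed)
    show "finite C" unfolding C_def by (intro finite_lists_length_eq) auto
    fix A assume A: "finite A" "A \<subseteq> tuples M x"
    \<comment> \<open>The assumption speaks of nonempty sets only.\<close>
    obtain qs where "P (insert a0 A) qs"
      using fin[of "insert a0 A"] A a0 unfolding P_def by auto
    then show "\<exists>qs. P A qs \<and> map cell qs \<in> C" using cell unfolding P_def by blast
  qed (auto simp: P_def)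
  then obtain cs where cs: "cs \<in> C"
    "\<And>A. finite A \<Longrightarrow> A \<subseteq> tuples M x \<Longrightarrow> \<exists>qs. P A qs \<and> map cell qs = cs"
    by blast
  define s where "s i = fst (cs ! i)" for i
  define r where "r i = \<delta> * snd (cs ! i)" for i
  have s: "s i = 1 \<or> s i = -1" if "i < N" for i
  proof -
    have "cs ! i \<in> {1, -1} \<times> {0..\<lfloor>1 / \<delta>\<rfloor>}" using cs(1) that nth_mem[of i cs] unfolding C_def by blast
    then show ?thesis by (auto simp: s_def)
  qed
  define D where "D i = {r i .. r i + \<delta>}" for i
  have approx: "\<bar>s i * (t - u) - s i * (r i - u)\<bar> \<le> \<delta>" if "i < N" "t \<in> D i" for i t u
    using s[OF that(1)] that(2) by (auto simp: D_def)
  have cell_D: "snd (qs ! i) = s i" "F (fst (qs ! i)) \<in> D i"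
    if "map cell qs = cs" "length qs = N" "i < N" for qs i
  proof -
    have ci: "cs ! i = cell (qs ! i)" using that by auto
    then show "snd (qs ! i) = s i" by (simp add: s_def cell_def split: prod.splits)
    have "r i = \<delta> * \<lfloor>F (fst (qs ! i)) / \<delta>\<rfloor>"
      by (simp add: r_def ci cell_def split: prod.splits)
    moreover define q where "q = real_of_int \<lfloor>F (fst (qs ! i)) / \<delta>\<rfloor>"
    have "q \<le> F (fst (qs ! i)) / \<delta>" "F (fst (qs ! i)) / \<delta> \<le> q + 1"
      unfolding q_def by linarith+
    from this[THEN mult_left_mono, OF less_imp_le[OF \<delta>]]
    have "\<delta> * q \<le> F (fst (qs ! i))" "F (fst (qs ! i)) \<le> \<delta> * q + \<delta>"
      using \<delta> by (simp_all add: algebra_simps)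
    ultimately show "F (fst (qs ! i)) \<in> D i"
      by (simp add: D_def q_def)
  qed
  define bad where "bad B \<longleftrightarrow> (\<Sum>i<N. s i * (r i - of_bool (i \<in> B))) < (c - \<delta>) * N" for B
  define slot where "slot i v = prod_encode (i, v)" for i v :: nat
  define Q where "Q j e = (case j of
      Inl (i, \<psi>) \<Rightarrow> sat (with_params U) (\<lambda>v. e (slot i v)) \<psi>
    | Inr (a, B) \<Rightarrow> \<not> (\<forall>i\<in>{..<N}. sat (with_params U)
          (\<lambda>v. if v \<in> x then a v else e (slot i v)) \<phi> \<longleftrightarrow> i \<in> B))"
    for j :: "(nat \<times> ('f + 'a, 'r) fm) + ((nat \<Rightarrow> 'a) \<times> nat set)" and e
  define J where "J = Inl ` {(i, \<psi>). i < N \<and> \<psi> \<in> fmls (param_lang L (univ M)) y \<and>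
        (\<forall>b\<in>tuples U y. F b \<in> D i \<longrightarrow> sat (with_params U) b \<psi>)}
    \<union> Inr ` (tuples M x \<times> {B. B \<subseteq> {..<N} \<and> bad B})"
  have fvx: "fv \<phi> \<subseteq> x \<union> y" using \<phi> by (simp add: fmls_def)
  have MU: "tuples M x \<subseteq> tuples U x" using M(1) by (auto simp: tuples_def PiE_def Pi_def)
  have inst_iff: "sat (with_params U) (\<lambda>v. if v \<in> x then a v else e (slot i v)) \<phi> \<longleftrightarrow> E a b"
    if "a \<in> tuples M x" "\<And>v. v \<in> y \<Longrightarrow> e (slot i v) = b v" for a b e i
    unfolding E_def by (rule sat_inst_iff[OF fvx xy]) (use that MU xy in auto)
  have "\<exists>e. range e \<subseteq> univ U \<and> (\<forall>j\<in>J. Q j e)"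
  proof (rule saturation_for_predicates[OF \<kappa> sat ne M(1,2)])
    fix j assume j: "j \<in> J"
    show "definable L U (univ M) UNIV (Q j)"
    proof (cases j)
      case (Inl p)
      then obtain i \<psi> where p: "p = (i, \<psi>)" "\<psi> \<in> fmls (param_lang L (univ M)) y"
        using j by (auto simp: J_def)
      have "definable L U (univ M) UNIV
          (\<lambda>e. sat (with_params U) (\<lambda>v. case_sum id e (Inr (slot i v) :: 'a + nat)) \<psi>)"
        using p(2) by (rule definable_subst) auto
      then show ?thesis by (simp add: Q_def[abs_def] Inl p(1))
    next
      case (Inr p)
      then obtain a B where p: "p = (a, B)" "a \<in> tuples M x" using j by (auto simp: J_def)
      have "definable L U (univ M) UNIV
          (\<lambda>e. sat (with_params U) (\<lambda>v. if v \<in> x then a v else e (slot i v)) \<phi>)" for i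
      proof -
        define \<sigma> where "\<sigma> v = (if v \<in> x then Inl (a v) else Inr (slot i v))" for v
        have "definable L U (univ M) UNIV (\<lambda>e. sat (with_params U) (\<lambda>v. case_sum id e (\<sigma> v)) \<phi>)"
          using \<phi> by (rule definable_subst) (use p(2) in \<open>auto simp: \<sigma>_def tuples_def\<close>)
        moreover have "case_sum id e (\<sigma> v) = (if v \<in> x then a v else e (slot i v))" for e v
          by (simp add: \<sigma>_def)
        ultimately show ?thesis by simp
      qed
      then have "definable L U (univ M) UNIV (\<lambda>e. \<not> (\<forall>i\<in>{..<N}. sat (with_params U)
          (\<lambda>v. if v \<in> x then a v else e (slot i v)) \<phi> \<longleftrightarrow> i \<in> B))"
        by (intro definable_not definable_finite_ball definable_iff_const) auto
      then show ?thesis by (simp add: Q_def[abs_def] Inr p(1))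
    qed
  next
    fix J0 assume J0: "finite J0" "J0 \<subseteq> J"
    define A where "A = fst ` (Inr -` J0)"
    have "finite A" unfolding A_def using J0(1) by (intro finite_imageI finite_vimageI) auto
    moreover have "A \<subseteq> tuples M x" using J0(2) by (auto simp: A_def J_def)
    ultimately obtain qs where "P A qs" and col: "map cell qs = cs" using cs(2) by blast
    then have qs: "set qs \<subseteq> tuples U y \<times> {1, -1}" "length qs = N"
      "\<And>a. a \<in> A \<Longrightarrow> mean (deviation F E a) qs \<ge> c" by (auto simp: P_def)
    note cd = cell_D[OF col qs(2)]
    have fst_qs: "fst (qs ! i) \<in> tuples U y" if "i < N" for i
    proof -
      have "qs ! i \<in> tuples U y \<times> {1, -1}" using qs(1,2) that nth_mem by blast
      then show ?thesis by (simp add: mem_Times_iff)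
    qed
    obtain u where u: "u \<in> univ U" using ne by blast
    define e where "e w = (let i = fst (prod_decode w); v = snd (prod_decode w) in
        if i < N \<and> v \<in> y then fst (qs ! i) v else u)" for w
    have e: "e (slot i v) = fst (qs ! i) v" if "i < N" "v \<in> y" for i v
      using that by (simp add: e_def slot_def)
    have "e w \<in> univ U" for w
    proof (cases "fst (prod_decode w) < N \<and> snd (prod_decode w) \<in> y")
      case True
      then show ?thesis
        using fst_qs[of "fst (prod_decode w)"] by (auto simp: e_def Let_def tuples_def PiE_iff)
    next
      case False
      then show ?thesis using u by (auto simp: e_def Let_def)
    qed
    moreover have "Q j e" if j: "j \<in> J0" for j
    proof (cases j)
      case (Inl p)
      then obtain i \<psi> where p: "p = (i, \<psi>)" "i < N" "\<psi> \<in> fmls (param_lang L (univ M)) y"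
        "\<And>b. b \<in> tuples U y \<Longrightarrow> F b \<in> D i \<Longrightarrow> sat (with_params U) b \<psi>"
        using j J0(2) by (auto simp: J_def)
      have "sat (with_params U) (fst (qs ! i)) \<psi>" using p(4) cd(2) fst_qs p(2) by blast
      moreover have "sat (with_params U) (\<lambda>v. e (slot i v)) \<psi> \<longleftrightarrow> sat (with_params U) (fst (qs ! i)) \<psi>"
        using p(2,3) e by (intro sat_cong) (auto simp: fmls_def)
      ultimately show ?thesis by (simp add: Q_def Inl p(1))
    next
      case (Inr p)
      then obtain a B where p: "p = (a, B)" "a \<in> tuples M x" "bad B" using j J0(2) by (auto simp: J_def)
      have a: "a \<in> A" using j Inr p(1) by (force simp: A_def)
      have "\<not> (\<forall>i\<in>{..<N}. E a (fst (qs ! i)) \<longleftrightarrow> i \<in> B)"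
      proof
        assume pat: "\<forall>i\<in>{..<N}. E a (fst (qs ! i)) \<longleftrightarrow> i \<in> B"
        have "c * N \<le> (\<Sum>i<N. s i * (F (fst (qs ! i)) - of_bool (i \<in> B)))"
          using qs(3)[OF a] N pat cd(1) by (simp add: mean_deviation_eq qs(2) le_divide_eq)
        also have "\<dots> \<le> (\<Sum>i<N. s i * (r i - of_bool (i \<in> B)) + \<delta>)"
        proof (rule sum_mono)
          fix i assume "i \<in> {..<N}"
          then show "s i * (F (fst (qs ! i)) - of_bool (i \<in> B)) \<le> s i * (r i - of_bool (i \<in> B)) + \<delta>"
            using approx[of i "F (fst (qs ! i))" "of_bool (i \<in> B)"] cd(2)[of i] by simp
        qed
        also have "\<dots> = (\<Sum>i<N. s i * (r i - of_bool (i \<in> B))) + \<delta> * N"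
          by (simp add: sum.distrib)
        finally show False using p(3) by (simp add: bad_def algebra_simps)
      qed
      moreover have "sat (with_params U) (\<lambda>v. if v \<in> x then a v else e (slot i v)) \<phi>
          \<longleftrightarrow> E a (fst (qs ! i))" if "i < N" for i
        using p(2) e[OF that] by (rule inst_iff)
      ultimately show ?thesis by (simp add: Q_def Inr p(1))
    qed
    ultimately show "\<exists>e. range e \<subseteq> univ U \<and> (\<forall>j\<in>J0. Q j e)" by (intro exI[of _ e]) auto
  qed
  then obtain e where e: "range e \<subseteq> univ U" "\<And>j. j \<in> J \<Longrightarrow> Q j e" by blast
  define b where "b i = (\<lambda>v\<in>y. e (slot i v))" for i
  have b: "b i \<in> tuples U y" for i using e(1) by (auto simp: b_def tuples_def)
  have FD: "F (b i) \<in> D i" if i: "i < N" for i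
    unfolding F_def
  proof (rule measure_preimage_type_definable[OF def _ b])
    show "closed (D i)" by (simp add: D_def)
    fix \<psi> assume \<psi>: "\<psi> \<in> fmls (param_lang L (univ M)) y"
      "\<forall>b'\<in>tuples U y. \<mu> (inst U x \<phi> b') \<in> D i \<longrightarrow> sat (with_params U) b' \<psi>"
    then have "Inl (i, \<psi>) \<in> J" using i by (auto simp: J_def F_def)
    then have "sat (with_params U) (\<lambda>v. e (slot i v)) \<psi>" using e(2) by (force simp: Q_def)
    moreover have "sat (with_params U) (\<lambda>v. e (slot i v)) \<psi> \<longleftrightarrow> sat (with_params U) (b i) \<psi>"
      using \<psi>(1) by (intro sat_cong) (auto simp: fmls_def b_def)
    ultimately show "sat (with_params U) (b i) \<psi>" by simp
  qed
  define qs where "qs = map (\<lambda>i. (b i, s i)) [0..<N]"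
  have "mean (deviation F E a) qs > 0" if a: "a \<in> tuples M x" for a
  proof -
    define B where "B = {i. i < N \<and> E a (b i)}"
    have "\<not> bad B"
    proof
      assume "bad B"
      then have "Inr (a, B) \<in> J" using a by (auto simp: J_def B_def)
      then have "\<not> (\<forall>i\<in>{..<N}. sat (with_params U)
          (\<lambda>v. if v \<in> x then a v else e (slot i v)) \<phi> \<longleftrightarrow> i \<in> B)"
        using e(2) by (force simp: Q_def)
      moreover have "sat (with_params U) (\<lambda>v. if v \<in> x then a v else e (slot i v)) \<phi> \<longleftrightarrow> E a (b i)" for i
        using a by (rule inst_iff) (simp add: b_def)
      ultimately show False by (auto simp: B_def)
    qed
    then have "(c - \<delta>) * N \<le> (\<Sum>i<N. s i * (r i - of_bool (i \<in> B)))" by (simp add: bad_def)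
    also have "\<dots> \<le> (\<Sum>i<N. s i * (F (b i) - of_bool (i \<in> B)) + \<delta>)"
    proof (rule sum_mono)
      fix i assume "i \<in> {..<N}"
      then show "s i * (r i - of_bool (i \<in> B)) \<le> s i * (F (b i) - of_bool (i \<in> B)) + \<delta>"
        using approx[of i "F (b i)" "of_bool (i \<in> B)"] FD[of i] by simp
    qed
    also have "\<dots> = (\<Sum>i<N. s i * (F (b i) - of_bool (E a (b i)))) + \<delta> * N"
      by (simp add: sum.distrib B_def)
    finally have "(c - 2 * \<delta>) * N \<le> (\<Sum>i<N. s i * (F (b i) - of_bool (E a (b i))))"
      by (simp add: algebra_simps)
    moreover have "0 < (c - 2 * \<delta>) * N" using c N by (simp add: \<delta>_def)
    ultimately have "0 < (\<Sum>i<N. s i * (F (b i) - of_bool (E a (b i))))" by linarith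
    then show ?thesis using N by (simp add: mean_deviation_eq qs_def)
  qed
  moreover have "set qs \<subseteq> tuples U y \<times> {1, -1}" "length qs = N"
    using b s unfolding qs_def by fastforce+
  ultimately show ?thesis by blast
qed

section \<open>Integration against a finitely satisfiable measure\<close>

text \<open>A hull need not have the defining property in general. Here it does, because there is at
least one algebra on the set that contains the generators (so that the intersection stays
inside the set), and algebras are closed under intersection.\<close>

lemma local_algebra_algebra: "algebra (tuples U x) (local_algebra U x y \<phi>)"
proof -
  define \<Omega> G where "\<Omega> = tuples U x" and "G = inst U x \<phi> ` tuples U y"
  have mem: "S \<in> algebra \<Omega> hull G \<longleftrightarrow> (\<forall>t. algebra \<Omega> t \<longrightarrow> G \<subseteq> t \<longrightarrow> S \<in> t)" for S
    by (auto simp: hull_def)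
  have "G \<subseteq> Pow \<Omega>" by (auto simp: inst_def G_def \<Omega>_def)
  moreover have "algebra \<Omega> (Pow \<Omega>)" by (auto simp: algebra_iff_Un)
  ultimately have "algebra \<Omega> hull G \<subseteq> Pow \<Omega>" by (rule hull_minimal)
  moreover have "{} \<in> algebra \<Omega> hull G" by (simp add: mem algebra_iff_Un)
  moreover have "\<Omega> - S \<in> algebra \<Omega> hull G" if "S \<in> algebra \<Omega> hull G" for S
    using that by (simp add: mem algebra_iff_Un)
  moreover have "S \<union> S' \<in> algebra \<Omega> hull G"
    if "S \<in> algebra \<Omega> hull G" "S' \<in> algebra \<Omega> hull G" for S S'
    using that by (simp add: mem algebra_iff_Un)
  ultimately have "algebra \<Omega> (algebra \<Omega> hull G)" by (subst algebra_iff_Un) blast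
  then show ?thesis by (simp add: local_algebra_def \<Omega>_def G_def)
qed

lemma instance_in_local_algebra:
  "b \<in> tuples U y \<Longrightarrow> inst U x \<phi> b \<in> local_algebra U x y \<phi>"
  unfolding local_algebra_def by (rule hull_inc) blast

lemma additive_finite_Union:
  fixes \<mu> :: "'b set \<Rightarrow> real"
  assumes alg: "algebra \<Omega> \<A>" and add: "Measure_Space.additive \<A> \<mu>"
    and "finite I" "\<And>i. i \<in> I \<Longrightarrow> E i \<in> \<A>" "disjoint_family_on E I"
  shows "\<mu> (\<Union>i\<in>I. E i) = (\<Sum>i\<in>I. \<mu> (E i))"
  using assms(3-5)
proof (induction I rule: finite_induct)
  case empty
  interpret algebra \<Omega> \<A> by (rule alg)
  show ?case using additiveD[OF add, of "{}" "{}"] by simp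
next
  case (insert j I)
  interpret algebra \<Omega> \<A> by (rule alg)
  have "disjoint_family_on E I" using insert.prems(2) by (auto simp: disjoint_family_on_def)
  then have "\<mu> (\<Union>i\<in>I. E i) = (\<Sum>i\<in>I. \<mu> (E i))" using insert by auto
  moreover have "\<mu> (E j \<union> (\<Union>i\<in>I. E i)) = \<mu> (E j) + \<mu> (\<Union>i\<in>I. E i)"
  proof (rule additiveD[OF add])
    show "E j \<inter> (\<Union>i\<in>I. E i) = {}"
      using insert.prems(2) insert.hyps(2) by (fastforce simp: disjoint_family_on_def)
    show "(\<Union>i\<in>I. E i) \<in> \<A>" using insert.hyps(1) insert.prems(1) by (intro finite_UN) auto
  qed (use insert.prems(1) in auto)
  ultimately show ?case using insert.hyps by simp
qed

text \<open>The sets \<open>atom B\<close> are the atoms, possibly empty, of the algebra generated by the sets \<open>G i\<close>.\<close>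

lemma measure_partition_by_pattern:
  fixes N :: nat and \<mu> :: "'b set \<Rightarrow> real"
  assumes alg: "algebra \<Omega> \<A>" and add: "Measure_Space.additive \<A> \<mu>"
    and G: "\<And>i. i < N \<Longrightarrow> G i \<in> \<A>" and S: "S \<in> \<A>"
  defines "atom B \<equiv> {a\<in>\<Omega>. \<forall>i\<in>{..<N}. a \<in> G i \<longleftrightarrow> i \<in> B}"
  shows "atom B \<in> \<A>" "\<mu> S = (\<Sum>B\<in>Pow {..<N}. \<mu> (atom B \<inter> S))"
proof -
  interpret algebra \<Omega> \<A> by (rule alg)
  have atom: "atom B \<in> \<A>" for B
    unfolding atom_def
  proof (rule sets_Collect_finite_All)
    fix i assume "i \<in> {..<N}"
    then have "G i \<in> \<A>" using G by simp
    moreover from this have "{a\<in>\<Omega>. a \<in> G i \<longleftrightarrow> i \<in> B} = (if i \<in> B then G i else \<Omega> - G i)"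
      using sets_into_space by auto
    ultimately show "{a\<in>\<Omega>. a \<in> G i \<longleftrightarrow> i \<in> B} \<in> \<A>" by auto
  qed simp
  then show "atom B \<in> \<A>" .
  have "(\<Sum>B\<in>Pow {..<N}. \<mu> (atom B \<inter> S)) = \<mu> (\<Union>B\<in>Pow {..<N}. atom B \<inter> S)"
  proof (rule additive_finite_Union[OF alg add, symmetric])
    show "disjoint_family_on (\<lambda>B. atom B \<inter> S) (Pow {..<N})"
      by (auto simp: disjoint_family_on_def atom_def)
  qed (use atom S in auto)
  also have "(\<Union>B\<in>Pow {..<N}. atom B \<inter> S) = S"
  proof -
    have "a \<in> (\<Union>B\<in>Pow {..<N}. atom B \<inter> S)" if "a \<in> S" for a
      using that S sets_into_space
      by (intro UN_I[of "{i. i < N \<and> a \<in> G i}"]) (auto simp: atom_def)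
    then show ?thesis by auto
  qed
  finally show "\<mu> S = (\<Sum>B\<in>Pow {..<N}. \<mu> (atom B \<inter> S))" by simp
qed

lemma instance_measure_bounds:
  assumes "local_measure U x y \<phi> \<mu>" "b \<in> tuples U y"
  shows "0 \<le> \<mu> (inst U x \<phi> b)" "\<mu> (inst U x \<phi> b) \<le> 1"
proof -
  let ?A = "local_algebra U x y \<phi>"
  interpret algebra "tuples U x" ?A by (rule local_algebra_algebra)
  have G: "inst U x \<phi> b \<in> ?A" using assms(2) by (rule instance_in_local_algebra)
  show nn: "0 \<le> \<mu> (inst U x \<phi> b)" using assms(1) G by (simp add: local_measure_def)
  have "\<mu> (inst U x \<phi> b \<union> (tuples U x - inst U x \<phi> b))
      = \<mu> (inst U x \<phi> b) + \<mu> (tuples U x - inst U x \<phi> b)"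
    using assms(1) G by (intro additiveD) (auto simp: local_measure_def)
  moreover have "inst U x \<phi> b \<union> (tuples U x - inst U x \<phi> b) = tuples U x"
    by (auto simp: inst_def)
  moreover have "0 \<le> \<mu> (tuples U x - inst U x \<phi> b)"
    using assms(1) G by (auto simp: local_measure_def)
  ultimately show "\<mu> (inst U x \<phi> b) \<le> 1" using assms(1) by (simp add: local_measure_def)
qed

text \<open>The mean deviation has \<open>\<mu>\<close>-integral \<open>0\<close>, since \<open>E a b\<close> integrates to \<open>F b\<close>. If it were
positive at every point of \<open>M\<close>, it would be positive on every atom of positive measure, as
such an atom has a point in \<open>M\<close>; then the integral would be positive.\<close>

lemma finitely_satisfiable_mean_deviation:
  assumes \<mu>: "local_measure U x y \<phi> \<mu>" and fs: "finitely_satisfiable_measure U M x y \<phi> \<mu>"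
    and qs: "set qs \<subseteq> tuples U y \<times> R" "qs \<noteq> []"
  shows "\<exists>a\<in>tuples M x. mean (deviation (\<lambda>b. \<mu> (inst U x \<phi> b)) (\<lambda>a b. a \<in> inst U x \<phi> b) a) qs \<le> 0"
proof (rule ccontr)
  let ?A = "local_algebra U x y \<phi>"
  define N where "N = length qs"
  define b s where "b i = fst (qs ! i)" and "s i = snd (qs ! i)" for i
  have b: "b i \<in> tuples U y" if "i < N" for i
  proof -
    have "qs ! i \<in> tuples U y \<times> R" using qs(1) nth_mem that unfolding N_def by blast
    then show ?thesis by (auto simp: b_def)
  qed
  define G where "G i = inst U x \<phi> (b i)" for i
  define atom where "atom B = {a\<in>tuples U x. \<forall>i\<in>{..<N}. a \<in> G i \<longleftrightarrow> i \<in> B}" for B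
  define h where "h B = (\<Sum>i<N. s i * (\<mu> (G i) - of_bool (i \<in> B)))" for B
  assume "\<not> ?thesis"
  then have pos: "0 < (\<Sum>i<N. s i * (\<mu> (G i) - of_bool (a \<in> G i)))" if "a \<in> tuples M x" for a
    using that qs(2) by (force simp: mean_deviation_eq N_def b_def s_def G_def zero_less_divide_iff not_le)
  interpret algebra "tuples U x" ?A by (rule local_algebra_algebra)
  have nn: "\<And>S. S \<in> ?A \<Longrightarrow> 0 \<le> \<mu> S" and add: "Measure_Space.additive ?A \<mu>" and one: "\<mu> (tuples U x) = 1"
    using \<mu> by (auto simp: local_measure_def)
  have G: "G i \<in> ?A" if "i < N" for i
    unfolding G_def using b[OF that] by (rule instance_in_local_algebra)
  have atom: "atom B \<in> ?A" for B
    unfolding atom_def using local_algebra_algebra add G top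
    by (rule measure_partition_by_pattern(1))
  have split: "\<mu> S = (\<Sum>B\<in>Pow {..<N}. \<mu> (atom B \<inter> S))" if "S \<in> ?A" for S
    unfolding atom_def using local_algebra_algebra add G that
    by (rule measure_partition_by_pattern(2))
  have empty: "\<mu> {} = 0" using additiveD[OF add, of "{}" "{}"] by simp
  have sum1: "(\<Sum>B\<in>Pow {..<N}. \<mu> (atom B)) = 1"
  proof -
    have "atom B \<inter> tuples U x = atom B" for B by (auto simp: atom_def)
    then show ?thesis using split[OF top] one by simp
  qed
  have sumG: "(\<Sum>B\<in>Pow {..<N}. \<mu> (atom B) * of_bool (i \<in> B)) = \<mu> (G i)" if i: "i < N" for i
  proof -
    have "atom B \<inter> G i = (if i \<in> B then atom B else {})" for B
      using i by (auto simp: atom_def)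
    then have "\<mu> (atom B \<inter> G i) = \<mu> (atom B) * of_bool (i \<in> B)" for B
      by (simp add: empty)
    then show ?thesis using split[OF G[OF i]] by simp
  qed
  have "(\<Sum>B\<in>Pow {..<N}. \<mu> (atom B) * h B)
      = (\<Sum>i<N. \<Sum>B\<in>Pow {..<N}. s i * (\<mu> (atom B) * \<mu> (G i) - \<mu> (atom B) * of_bool (i \<in> B)))"
    unfolding h_def sum_distrib_left by (subst sum.swap) (simp add: algebra_simps)
  also have "\<dots> = (\<Sum>i<N. s i * ((\<Sum>B\<in>Pow {..<N}. \<mu> (atom B)) * \<mu> (G i)
      - (\<Sum>B\<in>Pow {..<N}. \<mu> (atom B) * of_bool (i \<in> B))))"
    by (simp only: sum_distrib_left[symmetric] sum_subtractf sum_distrib_right[symmetric])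
  also have "\<dots> = 0" using sumG by (simp add: sum1)
  finally have zero: "(\<Sum>B\<in>Pow {..<N}. \<mu> (atom B) * h B) = 0" .
  have h_pos: "0 < h B" if B: "0 < \<mu> (atom B)" for B
  proof -
    obtain a where a: "a \<in> tuples M x" "a \<in> atom B"
      using fs[unfolded finitely_satisfiable_measure_def, rule_format, OF atom B] by blast
    have "h B = (\<Sum>i<N. s i * (\<mu> (G i) - of_bool (a \<in> G i)))"
      unfolding h_def using a(2) by (intro sum.cong) (auto simp: atom_def)
    then show ?thesis using pos[OF a(1)] by simp
  qed
  have atom_nn: "0 \<le> \<mu> (atom B)" for B using nn[OF atom] .
  have nonneg: "0 \<le> \<mu> (atom B) * h B" for B
  proof (cases "\<mu> (atom B) = 0")
    case False
    then have "0 < \<mu> (atom B)" using atom_nn[of B] by linarith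
    then show ?thesis using h_pos[of B] by simp
  qed simp
  have "\<mu> (atom B) = 0" if "B \<in> Pow {..<N}" for B
  proof (rule ccontr)
    assume "\<mu> (atom B) \<noteq> 0"
    then have "0 < \<mu> (atom B)" using atom_nn[of B] by linarith
    then have "0 < \<mu> (atom B) * h B" using h_pos[of B] by simp
    also have "\<dots> \<le> (\<Sum>B\<in>Pow {..<N}. \<mu> (atom B) * h B)"
      using that nonneg by (intro member_le_sum) auto
    finally show False using zero by simp
  qed
  then show False using sum1 by simp
qed

section \<open>Approximation by averages\<close>

lemma Av_eq_mean: "Av as S = mean (\<lambda>a. of_bool (a \<in> S)) as"
proof -
  have "sum_list (map (\<lambda>a. of_bool (a \<in> S)) as) = (\<Sum>i<length as. of_bool (as ! i \<in> S) :: real)"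
    by (simp add: sum_list_sum_nth atLeast0LessThan)
  also have "\<dots> = card {i. i < length as \<and> as ! i \<in> S}"
    by (simp add: sum.If_cases of_bool_def Int_def conj_commute)
  finally show ?thesis by (simp add: Av_def mean_def)
qed

theorem theorem6p4:
  fixes L :: "('f, 'r) lang" and T :: "('f, 'r) fm set" and \<kappa> :: "'k rel"
    and U M :: "('f, 'r, 'a) fo_struct"
    and x y :: "nat set" and \<phi> :: "('f + 'a, 'r) fm"
    and \<mu> :: "(nat \<Rightarrow> 'a) set \<Rightarrow> real" and \<epsilon> :: real
  assumes "countable_lang L" and "complete_theory L T" and "monster_model L T \<kappa> U"
    and "elem_substruct L M U" and "small \<kappa> (univ M)"
    and "finite x" and "finite y" and "x \<inter> y = {}"
    and "\<phi> \<in> fmls (param_lang L (univ M)) (x \<union> y)"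
    and "local_measure U x y \<phi> \<mu>"
    and "NIP U x y \<phi>"
    and "definable_measure L U M x y \<phi> \<mu>"
    and "finitely_satisfiable_measure U M x y \<phi> \<mu>"
    and "\<epsilon> > 0"
  shows "\<exists>as. as \<noteq> [] \<and> set as \<subseteq> tuples M x \<and>
    (SUP b\<in>tuples U y. \<bar>\<mu> (inst U x \<phi> b) - Av as (inst U x \<phi> b)\<bar>) < \<epsilon>"
proof (rule ccontr)
  assume contra: "\<not> ?thesis"
  have \<kappa>: "Card_order \<kappa>" "natLeq <o \<kappa>" and sat: "saturated L \<kappa> U"
    using assms(3) by (auto simp: monster_model_def)
  have M: "univ M \<subseteq> univ U" "univ M \<noteq> {}" and ne: "univ U \<noteq> {}"
    using assms(4) by (auto simp: elem_substruct_def is_struct_def)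
  define F where "F b = \<mu> (inst U x \<phi> b)" for b
  define E where "E a b \<longleftrightarrow> a \<in> inst U x \<phi> b" for a b
  have F: "F ` tuples U y \<subseteq> {0..1}"
    using instance_measure_bounds[OF assms(10)] by (auto simp: F_def)
  have MU: "tuples M x \<subseteq> tuples U x" using M(1) by (auto simp: tuples_def PiE_def Pi_def)
  obtain u where "u \<in> univ U" using ne by blast
  then have "(\<lambda>v\<in>y. u) \<in> tuples U y" by (auto simp: tuples_def)
  then have Y: "tuples U y \<noteq> {}" by blast
  \<comment> \<open>The factor \<open>1/2\<close> makes the final inequality strict, since a supremum of values
    below \<open>\<epsilon>\<close> may equal \<open>\<epsilon>\<close>; the bound \<open>1\<close> keeps the rate of the multiplicative weights small.\<close>
  define \<epsilon>' where "\<epsilon>' = min (\<epsilon> / 2) 1"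
  have \<epsilon>': "0 < \<epsilon>'" "\<epsilon>' \<le> 1" using assms(14) by (auto simp: \<epsilon>'_def)
  have bad: "\<exists>b\<in>tuples U y. \<bar>F b - mean (\<lambda>a. of_bool (E a b)) as\<bar> \<ge> \<epsilon>'"
    if "as \<noteq> []" "set as \<subseteq> tuples M x" for as
  proof (rule ccontr)
    assume "\<not> ?thesis"
    then have "\<bar>F b - mean (\<lambda>a. of_bool (E a b)) as\<bar> < \<epsilon>'" if "b \<in> tuples U y" for b
      using that by (meson not_le)
    then have "\<bar>\<mu> (inst U x \<phi> b) - Av as (inst U x \<phi> b)\<bar> \<le> \<epsilon> / 2" if "b \<in> tuples U y" for b
      using that unfolding Av_eq_mean F_def E_def \<epsilon>'_def by (meson less_imp_le min_less_iff_conj)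
    then have "(SUP b\<in>tuples U y. \<bar>\<mu> (inst U x \<phi> b) - Av as (inst U x \<phi> b)\<bar>) \<le> \<epsilon> / 2"
      using Y by (intro cSUP_least)
    then show False using contra that assms(14) by force
  qed
  obtain d where d: "\<And>S. finite S \<Longrightarrow> S \<subseteq> tuples U y \<Longrightarrow>
      shatters ((\<lambda>a. {b\<in>S. E a b}) ` tuples U x) S \<Longrightarrow> card S \<le> d"
    using NIP_bounds_dual_shattering[OF \<kappa> sat ne M(1) assms(5,8,9,11)] unfolding E_def by blast
  have vc: "card S \<le> d" if "finite S" "S \<subseteq> tuples U y"
    "shatters ((\<lambda>a. {b\<in>S. E a b}) ` tuples M x) S" for S
    using that(1,2) by (rule d) (use that(3) MU in \<open>unfold shatters_def, meson image_mono subsetD\<close>)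
  have "\<exists>N>0. \<forall>A. finite A \<longrightarrow> A \<noteq> {} \<longrightarrow> A \<subseteq> tuples M x \<longrightarrow>
     (\<exists>qs. set qs \<subseteq> tuples U y \<times> {1, -1} \<and> length qs = N \<and>
       (\<forall>a\<in>A. mean (deviation F E a) qs \<ge> \<epsilon>' / 16))"
    using \<epsilon>' F bad vc by (rule bounded_deviation_sample)
  then obtain N where N: "0 < N" "\<forall>A. finite A \<longrightarrow> A \<noteq> {} \<longrightarrow> A \<subseteq> tuples M x \<longrightarrow>
     (\<exists>qs. set qs \<subseteq> tuples U y \<times> {1, -1} \<and> length qs = N \<and>
       (\<forall>a\<in>A. mean (deviation F E a) qs \<ge> \<epsilon>' / 16))"
    by (elim exE conjE) (rule that)
  have "\<exists>qs. set qs \<subseteq> tuples U y \<times> {1, -1} \<and> length qs = N \<and>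
         (\<forall>a\<in>tuples M x. mean (deviation F E a) qs > 0)"
    unfolding F_def[abs_def] E_def[abs_def]
  proof (rule uniform_deviation_sample[OF \<kappa> sat ne M(1) assms(5) M(2) assms(8,9,12)])
    show "0 < \<epsilon>' / 16" using \<epsilon>'(1) by simp
    show "(\<lambda>b. \<mu> (inst U x \<phi> b)) ` tuples U y \<subseteq> {0..1}" using F unfolding F_def[abs_def] .
    show "0 < N" by (rule N(1))
    show "\<exists>qs. set qs \<subseteq> tuples U y \<times> {1, -1} \<and> length qs = N \<and>
        (\<forall>a\<in>A. \<epsilon>' / 16 \<le> mean (deviation (\<lambda>b. \<mu> (inst U x \<phi> b)) (\<lambda>a b. a \<in> inst U x \<phi> b) a) qs)"
      if "finite A" "A \<noteq> {}" "A \<subseteq> tuples M x" for A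
      using N(2)[rule_format, OF that] unfolding F_def[abs_def] E_def[abs_def] .
  qed
  then obtain qs where qs: "set qs \<subseteq> tuples U y \<times> {1, -1}" "length qs = N"
    "\<forall>a\<in>tuples M x. mean (deviation F E a) qs > 0"
    by blast
  have "qs \<noteq> []" using qs(2) N(1) by auto
  from finitely_satisfiable_mean_deviation[OF assms(10,13) qs(1) this]
  obtain a where "a \<in> tuples M x" "mean (deviation F E a) qs \<le> 0"
    unfolding F_def[abs_def] E_def[abs_def] by blast
  then show False using qs(3) by fastforce
qed

end
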